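(* Let $\alpha=[a_0;a_1,a_2,\dots]$ be irrational with $\sup_{k \ge 1} a_k = \infty$, with convergent denominators $q_k$. Then \[ P_{q_{k_m}} (\alpha, (-1)^{k_m} x/q_{k_m}) \to |2 \sin (\pi x)| \qquad \text{as } m \to \infty \] locally uniformly in $x\in\mathbb{R}$, for any increasing sequence of positive integers $k_m$ such that \[ \frac{1+\log \max_{1 \le \ell \le k_m} a_{\ell}}{a_{k_m+1}} \to 0 \qquad \text{as } m \to \infty . \] If in addition $\lim_{k \to \infty} (1+\log a_k)/a_{k+1}=0$, then the same holds along the full sequence $k_m=m$.
   Context: For real $\alpha,x$ and integer $N\ge0$, $P_N(\alpha,x)=\prod_{n=1}^N|2\sin(\pi(n\alpha+x))|$. $q_k$ are the denominators of the convergents $[a_0;a_1,\dots,a_k]$ of $\alpha$. *)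

theory Defs
  imports "HOL-Analysis.Analysis"
begin

fun cf_rest :: "real \<Rightarrow> nat \<Rightarrow> real" where
  "cf_rest \<alpha> 0 = \<alpha>"
| "cf_rest \<alpha> (Suc k) = 1 / frac (cf_rest \<alpha> k)"

definition cf_a :: "real \<Rightarrow> nat \<Rightarrow> int" where
  "cf_a \<alpha> k = \<lfloor>cf_rest \<alpha> k\<rfloor>"

fun cf_q :: "real \<Rightarrow> nat \<Rightarrow> int" where
  "cf_q \<alpha> 0 = 1"
| "cf_q \<alpha> (Suc 0) = cf_a \<alpha> 1"
| "cf_q \<alpha> (Suc (Suc k)) = cf_a \<alpha> (Suc (Suc k)) * cf_q \<alpha> (Suc k) + cf_q \<alpha> k"

definition sine_prod :: "nat \<Rightarrow> real \<Rightarrow> real \<Rightarrow> real" where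
  "sine_prod N \<alpha> x = (\<Prod>n=1..N. \<bar>2 * sin (pi * (real n * \<alpha> + x))\<bar>)"

end

theory Submission
  imports Defs
begin

text \<open>
  Write \<open>q = q\<^sub>k\<close>, \<open>r = q\<^bsub>k-1\<^esub>\<close> and \<open>q \<alpha> - p = (-1) ^ k * \<delta>\<close>, so that \<open>\<eta> = q * \<delta> \<le> 1 / a\<^bsub>k+1\<^esub>\<close>.
  Since \<open>p * r\<close> is \<open>\<plusminus>1\<close> modulo \<open>q\<close>, reindexing the factors by residues turns the product into that of
  \<open>\<bar>2 * sin (pi * (m + y + \<eta> * saw (m * r / q)) / q)\<bar>\<close> over \<open>m\<close> modulo \<open>q\<close>, where \<open>saw t = 1/2 - frac t\<close> and
  \<open>y = x + \<eta> / 2\<close>. Without the term containing \<open>saw\<close> it equals \<open>\<bar>2 * sin (pi * y)\<bar>\<close>. The factor closest to a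
  zero of the sine is compared directly. For the others, the logarithm of the ratio is \<open>\<eta>\<close> times a cotangent sum
  up to \<open>O(\<eta>)\<close>, and the partial fraction approximation of the cotangent reduces that sum to
  \<open>T\<^sub>k = (\<Sum>m<q. saw (m * r / q) / m)\<close>.
  Counting the lattice points below the line of slope \<open>\<beta>\<close> in two ways gives the reciprocity
  \<open>T(\<beta>) = - \<beta> * T(1 / \<beta>) + O(1 + ln (1 / \<beta>))\<close>. As \<open>q\<^sub>k / q\<^bsub>k-1\<^esub>\<close> is congruent to
  \<open>q\<^bsub>k-2\<^esub> / q\<^bsub>k-1\<^esub>\<close> modulo 1, it yields \<open>q\<^sub>k * \<bar>T\<^sub>k\<bar> \<le> C * (\<Sum>l\<le>k. q\<^sub>l * (1 + ln a\<^sub>l))\<close>. The \<open>q\<^sub>l\<close> grow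
  exponentially, so \<open>T\<^sub>k\<close> is \<open>O(1 + ln (Max a\<^sub>l))\<close>, and even \<open>O(1 + ln a\<^sub>k)\<close> if \<open>1 + ln a\<^sub>l = O(a\<^bsub>l+1\<^esub>)\<close>.
\<close>

section \<open>The sawtooth sum and its reciprocity\<close>

text \<open>Off the integers this is minus Dedekind's \<open>((t))\<close>. At an integer the value
  is 1/2 rather than 0, which matches residue 0 being represented by the index \<open>q\<close> in
  \<open>sine_prod_reindex\<close>.\<close>

definition saw :: "real \<Rightarrow> real" where "saw t = 1/2 - frac t"

lemma abs_saw_le: "\<bar>saw t\<bar> \<le> 1/2"
  unfolding saw_def using frac_ge_0[of t] frac_lt_1[of t] by linarith

lemma saw_add_of_int: "saw (t + of_int n) = saw t"
  by (simp add: saw_def)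

lemma saw_minus: "t \<notin> \<int> \<Longrightarrow> saw (- t) = - saw t"
  by (simp add: saw_def frac_neg)

section \<open>Asymptotics of harmonic numbers and factorials\<close>

text \<open>For \<open>n\<close> the floor of \<open>y\<close>, \<open>harm n\<close> is
  \<open>ln n + euler_mascheroni + 1 / (2 * n)\<close> and \<open>ln n\<close> is
  \<open>ln y - frac y / n\<close>, both up to \<open>O(1 / n^2)\<close>; the two corrections
  combine to \<open>saw y / y\<close>. At \<open>y = j / \<beta>\<close> this creates the dual sum
  of the reciprocity.\<close>

lemma harm_approx:
  fixes y :: real
  assumes "y \<ge> 1" "y \<notin> \<int>"
  shows "\<bar>harm (nat \<lfloor>y\<rfloor>) - (ln y + euler_mascheroni + saw y / y)\<bar> \<le> 12 / y\<^sup>2"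
proof -
  define n where "n = nat \<lfloor>y\<rfloor>"
  define \<theta> where "\<theta> = frac y"
  have n1: "n \<ge> 1" using assms(1) by (simp add: n_def le_nat_iff)
  have y: "y = real n + \<theta>" using assms(1) by (simp add: n_def \<theta>_def frac_def)
  have \<theta>: "0 \<le> \<theta>" "\<theta> < 1" by (simp_all add: \<theta>_def frac_lt_1)
  define z where "z = 1 / real n"
  have z: "0 < z" "z \<le> 1" using n1 by (simp_all add: z_def)
  have sq: "a\<^sup>2 \<le> z\<^sup>2" if "0 \<le> a" "a \<le> z" for a using that by (intro power_mono) auto
  have e: "harm n - ln (real (Suc n)) + inverse (of_nat (2*(n+1))) \<le> (euler_mascheroni :: real)"
    "(euler_mascheroni :: real) \<le> harm n - ln (real (Suc n)) + inverse (of_nat (2*n))"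
    using euler_mascheroni_bounds[OF n1] by auto
  have l1: "\<bar>ln (1 + z) - z\<bar> \<le> z\<^sup>2" using z by (intro abs_ln_one_plus_x_minus_x_bound_nonneg) auto
  have l2: "\<bar>ln (1 + \<theta> * z) - \<theta> * z\<bar> \<le> z\<^sup>2"
  proof -
    have "\<theta> * z \<le> 1 * z" using z \<theta> by (intro mult_right_mono) auto
    thus ?thesis using z \<theta> order_trans[OF abs_ln_one_plus_x_minus_x_bound_nonneg sq[of "\<theta> * z"]] by auto
  qed
  have "1 + z = real (Suc n) / real n" using n1 by (simp add: z_def field_simps)
  hence s1: "ln (real (Suc n)) = ln (real n) + ln (1 + z)" using n1 by (simp add: ln_div)
  have "1 + \<theta> * z = y / real n" using n1 by (simp add: z_def y field_simps)
  hence s2: "ln y = ln (real n) + ln (1 + \<theta> * z)" using n1 assms(1) by (simp add: ln_div)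
  have i1: "inverse (of_nat (2*n)) = z / 2" by (simp add: z_def field_simps)
  have i2: "z / 2 - z\<^sup>2 / 2 \<le> inverse (real (2*(n+1)))"
    using n1 by (simp add: z_def field_simps power2_eq_square)
  have "\<bar>saw y / y - saw y * z\<bar> = \<bar>saw y\<bar> * \<bar>1 / y - z\<bar>"
    by (simp add: abs_mult[symmetric] algebra_simps)
  also have "\<dots> \<le> 1 * z\<^sup>2"
  proof (rule mult_mono)
    show "\<bar>saw y\<bar> \<le> 1" using \<theta> unfolding saw_def \<theta>_def by linarith
    have "z - 1 / y = \<theta> / (real n * y)" using n1 \<theta> by (simp add: z_def y field_simps)
    also have "\<dots> \<le> 1 / (real n * real n)" using n1 \<theta> y by (intro frac_le mult_mono) auto
    finally have "z - 1 / y \<le> z\<^sup>2" by (simp add: z_def power2_eq_square)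
    moreover have "1 / y \<le> z" using n1 \<theta> by (simp add: z_def y field_simps)
    ultimately show "\<bar>1 / y - z\<bar> \<le> z\<^sup>2" by simp
  qed auto
  finally have s3: "\<bar>saw y / y - saw y * z\<bar> \<le> z\<^sup>2" by simp
  have s4: "saw y * z = z / 2 - \<theta> * z" by (simp add: saw_def \<theta>_def algebra_simps)
  have "\<bar>harm n - (ln y + euler_mascheroni + saw y / y)\<bar> \<le> 3 * z\<^sup>2"
    using e l1 l2 i2 s3 z ln_add_one_self_le_self[of z] unfolding s1 s2 i1 s4 by linarith
  \<comment> \<open>As \<open>y < n + 1 <= 2 * n\<close>, \<open>z\<close> is at most
    \<open>2 / y\<close>.\<close>
  also have "\<dots> \<le> 3 * (2 / y)\<^sup>2"
    using n1 \<theta> by (intro mult_left_mono power_mono) (auto simp: z_def y field_simps)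
  finally show ?thesis by (simp add: n_def power_divide)
qed

text \<open>Covers \<open>harm M\<close>, whose integer argument \<open>harm_approx\<close>
  excludes. An error of order \<open>1 / n\<close> is enough, since \<open>harm M\<close> enters the
  reciprocity with coefficient \<open>N + 1/2\<close> and \<open>N <= M\<close>.\<close>

lemma harm_approx_coarse:
  assumes "n \<ge> 1"
  shows "(harm n :: real) - ln (real n) - euler_mascheroni \<in> {0..1 / real n}"
proof -
  have e: "harm n - ln (real (Suc n)) + inverse (of_nat (2*(n+1))) \<le> (euler_mascheroni :: real)"
    "(euler_mascheroni :: real) \<le> harm n - ln (real (Suc n)) + inverse (of_nat (2*n))"
    using euler_mascheroni_bounds[OF assms] by auto
  have "real (Suc n) = real n * (1 + 1 / real n)" using assms by (simp add: field_simps)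
  hence s1: "ln (real (Suc n)) = ln (real n) + ln (1 + 1 / real n)"
    using assms by (simp only: ln_mult_pos add_pos_pos zero_less_one zero_less_divide_1_iff of_nat_0_less_iff)
  have "ln (1 + 1 / real n) \<le> 1 / real n" by (intro ln_add_one_self_le_self) auto
  moreover have "2 * (1 / real n) / (1 + (1 + 1 / real n)) \<le> ln (1 + 1 / real n) - ln 1"
    using ln_inverse_approx_ge[of 1 "1 + 1 / real n"] assms by simp
  moreover have "1 / (2 * real n) \<le> 2 * (1 / real n) / (1 + (1 + 1 / real n))"
    using assms by (simp add: field_simps)
  moreover have "0 \<le> inverse (of_nat (2*(n+1)) :: real)" by simp
  ultimately show ?thesis using e s1 unfolding atLeastAtMost_iff inverse_eq_divide of_nat_mult of_nat_numeral ln_one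
    by - (rule conjI; linarith)
qed

lemma ln_fact_approx:
  assumes "n \<ge> 1"
  shows "ln (fact n) - ((real n + 1/2) * ln (real n) - real n) \<in> {0..1}"
proof -
  \<comment> \<open>The sharper lower bound makes the induction work: from its value 1 at
    \<open>n = 1\<close> the error decreases, by at most
    \<open>1 / (2 * n) - 1 / (2 * (n + 1))\<close> per step, and these losses telescope.\<close>
  have "ln (fact n) - ((real n + 1/2) * ln (real n) - real n) \<in> {1/2 + 1 / (2 * real n)..1}"
    using assms
  proof (induction n rule: nat_induct_at_least)
    case base
    show ?case by simp
  next
    case (Suc n)
    define x where "x = real n"
    have x: "x \<ge> 1" using Suc by (simp add: x_def)
    have "ln (fact (Suc n)) = ln (x + 1) + ln (fact n :: real)"
      by (simp add: ln_mult x_def add.commute)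
    hence f: "ln (fact (Suc n)) - ((real (Suc n) + 1/2) * ln (real (Suc n)) - real (Suc n))
       = ln (fact n) - ((x + 1/2) * ln x - x) + 1 - (x + 1/2) * (ln (x + 1) - ln x)"
      by (simp add: x_def algebra_simps)
    have "2 * (x + 1 - x) / (x + (x + 1)) \<le> ln (x + 1) - ln x"
      using x by (intro ln_inverse_approx_ge) auto
    hence "1 \<le> (x + 1/2) * (ln (x + 1) - ln x)"
      using x by (simp add: field_simps)
    moreover have "ln (x + 1) - ln x \<le> 1 * (inverse x + inverse (x + 1)) / 2"
      using x by (intro ln_inverse_approx_le) auto
    hence "(x + 1/2) * (ln (x + 1) - ln x) \<le> (x + 1/2) * (1 * (inverse x + inverse (x + 1)) / 2)"
      using x by (intro mult_left_mono) auto
    moreover have "(x + 1/2) * (1 * (inverse x + inverse (x + 1)) / 2) \<le> 1 + 1 / (2 * x) - 1 / (2 * (x + 1))"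
      using x by (simp add: field_simps) (intro divide_right_mono; simp)
    ultimately show ?case using Suc.IH f unfolding x_def[symmetric] of_nat_Suc atLeastAtMost_iff add.commute[of 1 x]
      by - (rule conjI; linarith)
  qed
  moreover have "0 \<le> 1 / (2 * real n)" by simp
  ultimately show ?thesis unfolding atLeastAtMost_iff by linarith
qed

section \<open>Lattice point counting and the reciprocity\<close>

text \<open>Both sides sum \<open>1 / m\<close> over the lattice points \<open>(m, j)\<close> with
  \<open>1 <= j <= m * \<beta>\<close> and \<open>1 <= m <= M\<close>, once by columns and once by
  rows.\<close>

lemma sum_floor_div_swap:
  fixes \<beta> :: real
  assumes "\<beta> > 0" and N: "N = nat \<lfloor>real M * \<beta>\<rfloor>"
    and nonint: "\<And>j. j \<in> {1..N} \<Longrightarrow> real j / \<beta> \<notin> \<int>"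
  shows "(\<Sum>m=1..M. of_int \<lfloor>real m * \<beta>\<rfloor> / real m)
       = (\<Sum>j=1..N. harm M - harm (nat \<lfloor>real j / \<beta>\<rfloor>))"
proof -
  have iff: "j \<le> nat \<lfloor>real m * \<beta>\<rfloor> \<longleftrightarrow> nat \<lfloor>real j / \<beta>\<rfloor> < m" if "j \<in> {1..N}" for j m
  proof -
    have "real j / \<beta> \<noteq> real m" using nonint[OF that] by auto
    have "j \<le> nat \<lfloor>real m * \<beta>\<rfloor> \<longleftrightarrow> real j \<le> real m * \<beta>" using assms(1) that by (simp add: le_nat_iff le_floor_iff)
    also have "\<dots> \<longleftrightarrow> real j / \<beta> \<le> real m" using assms(1) by (simp add: field_simps)
    also have "\<dots> \<longleftrightarrow> real j / \<beta> < real m" using \<open>real j / \<beta> \<noteq> real m\<close> by linarith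
    also have "\<dots> \<longleftrightarrow> nat \<lfloor>real j / \<beta>\<rfloor> < m" using assms(1) by (simp add: nat_less_iff floor_less_iff)
    finally show ?thesis .
  qed
  have "(\<Sum>m=1..M. of_int \<lfloor>real m * \<beta>\<rfloor> / real m)
      = (\<Sum>m=1..M. \<Sum>j\<in>{j\<in>{1..N}. nat \<lfloor>real j / \<beta>\<rfloor> < m}. 1 / real m)"
  proof (rule sum.cong[OF refl])
    fix m assume m: "m \<in> {1..M}"
    have "nat \<lfloor>real m * \<beta>\<rfloor> \<le> N"
      unfolding N using m assms(1) by (intro nat_mono floor_mono mult_right_mono) auto
    hence "{j\<in>{1..N}. nat \<lfloor>real j / \<beta>\<rfloor> < m} = {1..nat \<lfloor>real m * \<beta>\<rfloor>}"
      using iff[of _ m] by fastforce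
    thus "of_int \<lfloor>real m * \<beta>\<rfloor> / real m = (\<Sum>j\<in>{j\<in>{1..N}. nat \<lfloor>real j / \<beta>\<rfloor> < m}. 1 / real m)"
      using assms(1) by simp
  qed
  also have "\<dots> = (\<Sum>j=1..N. \<Sum>m\<in>{m\<in>{1..M}. nat \<lfloor>real j / \<beta>\<rfloor> < m}. 1 / real m)"
    by (rule sum.swap_restrict) auto
  also have "\<dots> = (\<Sum>j=1..N. harm M - harm (nat \<lfloor>real j / \<beta>\<rfloor>))"
  proof (rule sum.cong[OF refl])
    fix j assume j: "j \<in> {1..N}"
    define n where "n = nat \<lfloor>real j / \<beta>\<rfloor>"
    \<comment> \<open>The bound \<open>j <= N\<close> yields \<open>n < M\<close>, so that the row
      of \<open>j\<close> really is \<open>harm M\<close> minus \<open>harm n\<close>.\<close>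
    have "N \<le> nat \<lfloor>real M * \<beta>\<rfloor>" by (simp add: N)
    hence "n < M" using iff[OF j, of M] j by (simp add: n_def)
    hence "{1..M} = {1..n} \<union> {m\<in>{1..M}. n < m}" by auto
    hence "(\<Sum>m=1..M. 1 / real m) = (\<Sum>m\<in>{1..n} \<union> {m\<in>{1..M}. n < m}. 1 / real m)"
      by (rule arg_cong)
    also have "\<dots> = (\<Sum>m=1..n. 1 / real m) + (\<Sum>m\<in>{m\<in>{1..M}. n < m}. 1 / real m)"
      by (rule sum.union_disjoint) auto
    finally have "(harm M :: real) = harm n + (\<Sum>m\<in>{m\<in>{1..M}. n < m}. 1 / real m)"
      by (simp only: harm_def inverse_eq_divide)
    thus "(\<Sum>m\<in>{m\<in>{1..M}. nat \<lfloor>real j / \<beta>\<rfloor> < m}. 1 / real m) = harm M - harm (nat \<lfloor>real j / \<beta>\<rfloor>)"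
      by (simp add: n_def)
  qed
  finally show ?thesis .
qed

lemma sum_inverse_squares_le: "(\<Sum>i=1..n. 1 / (real i)\<^sup>2) \<le> 2"
proof -
  have "(\<Sum>i=1..n. 1 / (real i)\<^sup>2) \<le> 2 - 1 / real n" if "n \<ge> 1"
    using that
  proof (induction n rule: nat_induct_at_least)
    case (Suc n)
    have "1 / (real (Suc n))\<^sup>2 \<le> 1 / real n - 1 / real (Suc n)"
    proof -
      have "1 / (real (Suc n))\<^sup>2 \<le> 1 / (real n * real (Suc n))"
        unfolding power2_eq_square using Suc by (intro divide_left_mono mult_right_mono) auto
      also have "\<dots> = 1 / real n - 1 / real (Suc n)" using Suc by (simp add: field_simps)
      finally show ?thesis .
    qed
    thus ?case using Suc by simp
  qed auto
  moreover have "0 \<le> 1 / real n" by simp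
  ultimately show ?thesis by (cases "n = 0") (auto intro: order_trans)
qed

text \<open>
  The integrality hypothesis keeps every \<open>j / \<beta>\<close> off the jumps of \<open>saw\<close>, and lets the strict and weak
  inequalities in the two lattice point counts agree.
\<close>

lemma saw_sum_reciprocity:
  fixes \<beta> :: real
  assumes \<beta>: "0 < \<beta>" "\<beta> \<le> 1" and N: "N = nat \<lfloor>real M * \<beta>\<rfloor>"
    and nonint: "\<And>j. j \<in> {1..N} \<Longrightarrow> real j / \<beta> \<notin> \<int>"
  shows "\<bar>(\<Sum>m=1..M. saw (real m * \<beta>) / real m) + \<beta> * (\<Sum>j=1..N. saw (real j / \<beta>) / real j)\<bar>
         \<le> 32 - ln \<beta> / 2"
proof -
  define T where "T = (\<Sum>m=1..M. saw (real m * \<beta>) / real m)"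
  define T' where "T' = (\<Sum>j=1..N. saw (real j / \<beta>) / real j)"
  define L where "L = - ln \<beta>"
  have L: "L \<ge> 0" using \<beta> by (simp add: L_def)
  have "T = (\<Sum>m=1..M. inverse (real m) / 2 - \<beta> + of_int \<lfloor>real m * \<beta>\<rfloor> / real m)"
    unfolding T_def by (intro sum.cong) (auto simp: saw_def frac_def field_simps)
  also have "\<dots> = harm M / 2 - \<beta> * real M + (\<Sum>m=1..M. of_int \<lfloor>real m * \<beta>\<rfloor> / real m)"
    by (simp add: sum.distrib sum_subtractf sum_divide_distrib harm_def)
  also note sum_floor_div_swap[OF \<beta>(1) N nonint]
  finally have T: "T = harm M / 2 - \<beta> * real M + (\<Sum>j=1..N. harm M - harm (nat \<lfloor>real j / \<beta>\<rfloor>))" .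
  have MN: "real N \<le> real M * \<beta>" "real M * \<beta> < real N + 1" using \<beta> by (simp_all add: N)
  show ?thesis
  proof (cases "M = 0")
    case True
    moreover have "0 \<le> 32 - ln \<beta> / 2" using L unfolding L_def by linarith
    ultimately show ?thesis by (simp add: N)
  next
    case M: False
    define \<rho> where "\<rho> = harm M - ln (real M) - (euler_mascheroni :: real)"
    have \<rho>: "\<rho> \<in> {0..1 / real M}" unfolding \<rho>_def using harm_approx_coarse[of M] M by simp
    have \<rho>1: "\<rho> \<le> 1" using \<rho> M by (auto intro: order_trans)
    have g: "(euler_mascheroni :: real) \<in> {0..1}"
      using euler_mascheroni_pos euler_mascheroni_upper[of 0] ln2_ge_two_thirds by (simp add: harm_def) 
    show ?thesis
    proof (cases "N = 0")
      \<comment> \<open>The dual sum is empty and \<open>M < 1 / \<beta>\<close>, so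
        \<open>harm M / 2\<close> is what produces the term \<open>- ln \<beta> / 2\<close>.\<close>
      case True
      have "real M < 1 / \<beta>" using MN(2) True \<beta> by (simp add: field_simps)
      hence "ln (real M) \<le> L" using M \<beta> ln_le_cancel_iff[of "real M" "1 / \<beta>"] by (simp add: L_def ln_div)
      moreover have "0 \<le> ln (real M)" using M by simp
      moreover have "T = harm M / 2 - real M * \<beta>" using T True by (simp add: mult.commute)
      moreover have "(0 :: real) \<le> harm M" by (rule harm_nonneg)
      ultimately have "\<bar>T\<bar> \<le> 32 + L / 2" using True MN \<rho>1 g unfolding \<rho>_def atLeastAtMost_iff by linarith
      thus ?thesis using True by (simp add: T_def L_def)
    next
      case False
      define r where "r j = harm (nat \<lfloor>real j / \<beta>\<rfloor>) - (ln (real j / \<beta>) + euler_mascheroni + saw (real j / \<beta>) / (real j / \<beta>))" for j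
      have r: "\<bar>r j\<bar> \<le> 12 * (1 / (real j)\<^sup>2)" if j: "j \<in> {1..N}" for j
      proof -
        have "real j / \<beta> \<ge> 1" using j \<beta> by (simp add: field_simps)
        hence "\<bar>r j\<bar> \<le> 12 / (real j / \<beta>)\<^sup>2" unfolding r_def by (intro harm_approx nonint j)
        also have "\<dots> \<le> 12 / (real j)\<^sup>2" using j \<beta>
          by (intro divide_left_mono power_mono mult_pos_pos) (auto simp: field_simps)
        finally show ?thesis by simp
      qed
      have "\<bar>\<Sum>j=1..N. r j\<bar> \<le> (\<Sum>j=1..N. 12 * (1 / (real j)\<^sup>2))"
        by (rule order_trans[OF sum_abs]) (intro sum_mono r)
      also have "\<dots> \<le> 12 * 2" unfolding sum_distrib_left[symmetric] by (intro mult_left_mono sum_inverse_squares_le) auto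
      finally have R: "\<bar>\<Sum>j=1..N. r j\<bar> \<le> 24" by simp
      have "(\<Sum>j=1..N. ln (real j)) = ln (fact N)"
        by (subst fact_prod, subst of_nat_prod, subst ln_prod) auto
      hence s: "(\<Sum>j=1..N. harm (nat \<lfloor>real j / \<beta>\<rfloor>)) = ln (fact N) + real N * L + real N * euler_mascheroni + \<beta> * T' + (\<Sum>j=1..N. r j)"
      proof -
        have "(\<Sum>j=1..N. harm (nat \<lfloor>real j / \<beta>\<rfloor>)) = (\<Sum>j=1..N. ln (real j) + L + euler_mascheroni + \<beta> * (saw (real j / \<beta>) / real j) + r j)"
          using \<beta> by (intro sum.cong) (auto simp: r_def ln_div L_def)
        thus ?thesis using \<open>(\<Sum>j=1..N. ln (real j)) = ln (fact N)\<close>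
          by (simp add: sum.distrib T'_def sum_distrib_left)
      qed
      define \<sigma> where "\<sigma> = ln (fact N) - ((real N + 1/2) * ln (real N) - real N)"
      have \<sigma>: "\<sigma> \<in> {0..1}" unfolding \<sigma>_def using ln_fact_approx[of N] False by simp
      \<comment> \<open>\<open>\<kappa>\<close> is the cost of rounding \<open>M * \<beta>\<close>
        down to \<open>N\<close>; being at most \<open>1 / N\<close>, it stays bounded after
        multiplication by \<open>N + 1/2\<close>.\<close>
      define \<kappa> where "\<kappa> = ln (real M * \<beta> / real N)"
      have \<kappa>': "\<kappa> = ln (real M) - L - ln (real N)" using M False \<beta> by (simp add: \<kappa>_def ln_div ln_mult L_def)
      have \<kappa>: "0 \<le> \<kappa>" "\<kappa> \<le> 1 / real N"
      proof -
        show "0 \<le> \<kappa>" unfolding \<kappa>_def using MN False by (intro ln_ge_zero) (simp add: field_simps)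
        have "\<kappa> \<le> real M * \<beta> / real N - 1" unfolding \<kappa>_def using M \<beta> False by (intro ln_le_minus_one) simp
        also have "\<dots> = (real M * \<beta> - real N) / real N" using False by (simp add: field_simps)
        also have "\<dots> \<le> 1 / real N" using MN by (intro divide_right_mono) auto
        finally show "\<kappa> \<le> 1 / real N" .
      qed
      have \<kappa>3: "0 \<le> (real N + 1/2) * \<kappa>" "(real N + 1/2) * \<kappa> \<le> 3/2"
      proof -
        show "0 \<le> (real N + 1/2) * \<kappa>" using \<kappa> by simp
        have "(real N + 1/2) * \<kappa> \<le> (real N + 1/2) * (1 / real N)" using \<kappa> by (intro mult_left_mono) auto
        also have "\<dots> \<le> 3/2" using False by (simp add: field_simps)
        finally show "(real N + 1/2) * \<kappa> \<le> 3/2" .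
      qed
      have "real M * \<beta> \<le> real M * 1" using \<beta> by (intro mult_left_mono) auto
      hence NM: "real N \<le> real M" using MN by simp
      have \<rho>3: "0 \<le> (real N + 1/2) * \<rho>" "(real N + 1/2) * \<rho> \<le> 3/2"
      proof -
        show "0 \<le> (real N + 1/2) * \<rho>" using \<rho> by simp
        have "(real N + 1/2) * \<rho> \<le> (real M + 1/2) * (1 / real M)" using \<rho> NM by (intro mult_mono) auto
        also have "\<dots> \<le> 3/2" using M by (simp add: field_simps)
        finally show "(real N + 1/2) * \<rho> \<le> 3/2" .
      qed
      have "T + \<beta> * T' = (real N + 1/2) * harm M - \<beta> * real M - ln (fact N) - real N * L - real N * euler_mascheroni - (\<Sum>j=1..N. r j)"
        using T s by (simp add: sum_subtractf algebra_simps)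
      \<comment> \<open>Stirling's formula cancels the terms of size \<open>N * ln N\<close>, and
        the terms \<open>N * L\<close> cancel as well. Only \<open>L / 2\<close> is left
        unbounded.\<close>
      also have "\<dots> = (real N + 1/2) * \<kappa> + L / 2 + euler_mascheroni / 2 + (real N + 1/2) * \<rho> + (real N - real M * \<beta>) - \<sigma> - (\<Sum>j=1..N. r j)"
        unfolding \<sigma>_def \<rho>_def \<kappa>' by (simp add: algebra_simps add_divide_distrib)
      finally have "\<bar>T + \<beta> * T'\<bar> \<le> 32 + L / 2"
        using \<kappa>3 \<rho>3 R \<sigma> MN L g unfolding atLeastAtMost_iff by linarith
      thus ?thesis by (simp add: T_def T'_def L_def)
    qed
  qed
qed

section \<open>Continued fractions\<close>

lemma cf_rest_irrational: "\<alpha> \<notin> \<rat> \<Longrightarrow> cf_rest \<alpha> k \<notin> \<rat>"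
proof (induction k)
  case (Suc k)
  show ?case
  proof
    assume "cf_rest \<alpha> (Suc k) \<in> \<rat>"
    hence "inverse (cf_rest \<alpha> (Suc k)) \<in> \<rat>" by (rule Rats_inverse)
    hence "frac (cf_rest \<alpha> k) + of_int \<lfloor>cf_rest \<alpha> k\<rfloor> \<in> \<rat>" by (intro Rats_add) (auto simp: inverse_eq_divide)
    thus False using Suc by (simp add: frac_def)
  qed
qed auto

lemma frac_cf_rest_pos:
  assumes "\<alpha> \<notin> \<rat>"
  shows "0 < frac (cf_rest \<alpha> k)"
  using cf_rest_irrational[OF assms, of k] Ints_subset_Rats by auto

lemma cf_rest_Suc_gt_1:
  assumes "\<alpha> \<notin> \<rat>"
  shows "1 < cf_rest \<alpha> (Suc k)"
  using frac_cf_rest_pos[OF assms, of k] frac_lt_1[of "cf_rest \<alpha> k"] by simp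

lemma cf_a_Suc_ge_1: "\<alpha> \<notin> \<rat> \<Longrightarrow> 1 \<le> cf_a \<alpha> (Suc k)"
  using cf_rest_Suc_gt_1[of \<alpha> k] unfolding cf_a_def by linarith

lemma cf_a_ge_1: "\<alpha> \<notin> \<rat> \<Longrightarrow> 1 \<le> k \<Longrightarrow> 1 \<le> cf_a \<alpha> k"
  using cf_a_Suc_ge_1[of \<alpha> "k - 1"] by simp

text \<open>The index shift \<open>q\<^bsub>k-1\<^esub>\<close> with the convention \<open>q\<^bsub>-1\<^esub> = 0\<close>.\<close>

definition cf_q_pred :: "real \<Rightarrow> nat \<Rightarrow> int" where
  "cf_q_pred \<alpha> k = (case k of 0 \<Rightarrow> 0 | Suc j \<Rightarrow> cf_q \<alpha> j)"

lemma cf_q_pred_Suc [simp]: "cf_q_pred \<alpha> (Suc k) = cf_q \<alpha> k"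
  by (simp add: cf_q_pred_def)

lemma cf_q_Suc: "cf_q \<alpha> (Suc k) = cf_a \<alpha> (Suc k) * cf_q \<alpha> k + cf_q_pred \<alpha> k"
  by (cases k) (auto simp: cf_q_pred_def)

lemma cf_q_pos_aux:
  assumes "\<alpha> \<notin> \<rat>"
  shows "0 < cf_q \<alpha> k \<and> 0 \<le> cf_q_pred \<alpha> k"
proof (induction k)
  case (Suc k)
  thus ?case using cf_a_Suc_ge_1[OF assms, of k] by (simp add: cf_q_Suc add_pos_nonneg)
qed (auto simp: cf_q_pred_def)

lemma cf_q_pos: "\<alpha> \<notin> \<rat> \<Longrightarrow> 0 < cf_q \<alpha> k"
  and cf_q_pred_nonneg: "\<alpha> \<notin> \<rat> \<Longrightarrow> 0 \<le> cf_q_pred \<alpha> k"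
  using cf_q_pos_aux by auto

lemma cf_q_Suc_ge:
  assumes "\<alpha> \<notin> \<rat>"
  shows "cf_q \<alpha> k + cf_q_pred \<alpha> k \<le> cf_q \<alpha> (Suc k)"
  using mult_right_mono[OF cf_a_Suc_ge_1[OF assms, of k], of "cf_q \<alpha> k"] cf_q_pos[OF assms, of k]
  by (simp add: cf_q_Suc)

lemma cf_q_mono_Suc: "\<alpha> \<notin> \<rat> \<Longrightarrow> cf_q \<alpha> k \<le> cf_q \<alpha> (Suc k)"
  using cf_q_Suc_ge[of \<alpha> k] cf_q_pred_nonneg[of \<alpha> k] by simp

lemma cf_q_pred_le: "\<alpha> \<notin> \<rat> \<Longrightarrow> cf_q_pred \<alpha> k \<le> cf_q \<alpha> k"
  using cf_q_mono_Suc[of \<alpha> "k - 1"] by (cases k) (auto simp: cf_q_pred_def)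

text \<open>The witnesses are the numerators of the \<open>k\<close>-th convergent and of its predecessor.\<close>

lemma cf_numerators:
  assumes "\<alpha> \<notin> \<rat>"
  shows "\<exists>p p'. p * cf_q_pred \<alpha> k - p' * cf_q \<alpha> k = (-1) ^ Suc k \<and>
           \<alpha> * (of_int (cf_q \<alpha> k) * cf_rest \<alpha> (Suc k) + of_int (cf_q_pred \<alpha> k))
           = of_int p * cf_rest \<alpha> (Suc k) + of_int p'"
proof (induction k)
  case 0
  have "\<alpha> * (1 / frac \<alpha>) = of_int \<lfloor>\<alpha>\<rfloor> * (1 / frac \<alpha>) + 1"
    using frac_cf_rest_pos[OF assms, of 0] by (simp add: field_simps frac_def)
  thus ?case by (intro exI[of _ "\<lfloor>\<alpha>\<rfloor>"] exI[of _ 1]) (simp add: cf_q_pred_def)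
next
  case (Suc k)
  then obtain p p' where p: "p * cf_q_pred \<alpha> k - p' * cf_q \<alpha> k = (-1) ^ Suc k"
    "\<alpha> * (of_int (cf_q \<alpha> k) * cf_rest \<alpha> (Suc k) + of_int (cf_q_pred \<alpha> k))
     = of_int p * cf_rest \<alpha> (Suc k) + of_int p'" by blast
  define a r where "a = cf_a \<alpha> (Suc k)" and "r = cf_rest \<alpha> (Suc (Suc k))"
  have r: "r > 1" unfolding r_def by (rule cf_rest_Suc_gt_1[OF assms])
  have "frac (cf_rest \<alpha> (Suc k)) = 1 / r" by (simp add: r_def)
  hence x: "cf_rest \<alpha> (Suc k) = of_int a + 1 / r" by (simp add: a_def cf_a_def frac_def)
  have "\<alpha> * (of_int (cf_q \<alpha> k) * (of_int a + 1 / r) + of_int (cf_q_pred \<alpha> k)) * r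
      = (of_int p * (of_int a + 1 / r) + of_int p') * r"
    using p(2) unfolding x by simp
  hence "\<alpha> * (of_int (a * cf_q \<alpha> k + cf_q_pred \<alpha> k) * r + of_int (cf_q \<alpha> k))
      = of_int (a * p + p') * r + of_int p"
    using r by (simp add: algebra_simps)
  moreover have "(a * p + p') * cf_q \<alpha> k - p * (a * cf_q \<alpha> k + cf_q_pred \<alpha> k) = (-1) ^ Suc (Suc k)"
    using p(1) by (simp add: algebra_simps)
  ultimately show ?case
    unfolding cf_q_pred_Suc cf_q_Suc a_def[symmetric] r_def[symmetric] by blast
qed

lemma coprime_cf_q_pred:
  assumes "\<alpha> \<notin> \<rat>"
  shows "coprime (cf_q_pred \<alpha> k) (cf_q \<alpha> k)"
proof (rule coprimeI)
  fix d assume d: "d dvd cf_q_pred \<alpha> k" "d dvd cf_q \<alpha> k"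
  from cf_numerators[OF assms] obtain p p' where "p * cf_q_pred \<alpha> k - p' * cf_q \<alpha> k = (-1) ^ Suc k" by blast
  moreover have "d dvd p * cf_q_pred \<alpha> k - p' * cf_q \<alpha> k" using d by (intro dvd_diff dvd_mult)
  ultimately have "d dvd (-1) ^ Suc k" by simp
  thus "is_unit d" using dvd_trans[of d "(-1) ^ Suc k" 1] by (simp add: is_unit_power_iff)
qed

section \<open>The sawtooth sum along a continued fraction\<close>

text \<open>The solution of \<open>u (k+1) = q_k / q_(k+1) * u k + 1 + ln a_(k+1)\<close> with
  \<open>u 0 = 0\<close>, which is the recursion that the reciprocity gives for the sawtooth sums up
  to a constant factor.\<close>

definition cf_log_sum :: "real \<Rightarrow> nat \<Rightarrow> real" where
  "cf_log_sum \<alpha> k = (\<Sum>l=1..k. of_int (cf_q \<alpha> l) * (1 + ln (of_int (cf_a \<alpha> l)))) / of_int (cf_q \<alpha> k)"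

lemma of_int_divide_in_Ints_iff:
  fixes a b :: int
  assumes "b \<noteq> 0"
  shows "(of_int a / of_int b :: real) \<in> \<int> \<longleftrightarrow> b dvd a"
proof
  assume "(of_int a / of_int b :: real) \<in> \<int>"
  then obtain n where "(of_int a / of_int b :: real) = of_int n" by (auto elim: Ints_cases)
  hence "real_of_int a = of_int (n * b)" using assms by (simp add: field_simps)
  hence "a = n * b" by (simp only: of_int_eq_iff)
  thus "b dvd a" by simp
qed (use assms in auto)

text \<open>Induction along the Euclidean algorithm: the reciprocity replaces the slope
  \<open>\<beta> = q_k / q_(k+1)\<close> by \<open>1 / \<beta> = a_(k+1) + q_(k-1) / q_k\<close>,
  whose integer part \<open>saw\<close> ignores. The length \<open>M\<close> is arbitrary below
  \<open>q_k\<close> because the dual sum has its own length \<open>N\<close>, again below the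
  smaller denominator.\<close>

lemma saw_sum_le_cf_log_sum:
  assumes irr: "\<alpha> \<notin> \<rat>" and "int M < cf_q \<alpha> k"
  shows "\<bar>\<Sum>m=1..M. saw (real m * (of_int (cf_q_pred \<alpha> k) / of_int (cf_q \<alpha> k))) / real m\<bar>
         \<le> 33 * cf_log_sum \<alpha> k"
  using assms(2)
proof (induction k arbitrary: M)
  case 0
  thus ?case by (simp add: cf_log_sum_def)
next
  case (Suc k)
  define q q' a where "q = cf_q \<alpha> k" and "q' = cf_q \<alpha> (Suc k)" and "a = cf_a \<alpha> (Suc k)"
  have q: "0 < q" "q \<le> q'" "0 < q'"
    unfolding q_def q'_def using cf_q_pos[OF irr] cf_q_mono_Suc[OF irr] by auto
  have a: "1 \<le> a" unfolding a_def by (rule cf_a_Suc_ge_1[OF irr])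
  have rec: "q' = a * q + cf_q_pred \<alpha> k" unfolding q_def q'_def a_def by (rule cf_q_Suc)
  define \<beta> where "\<beta> = real_of_int q / real_of_int q'"
  define N where "N = nat \<lfloor>real M * \<beta>\<rfloor>"
  have \<beta>: "0 < \<beta>" "\<beta> \<le> 1" using q by (simp_all add: \<beta>_def)
  have "real M * \<beta> < real_of_int q' * \<beta>"
    using Suc.prems \<beta> unfolding q'_def[symmetric] by (intro mult_strict_right_mono) linarith+
  hence "real M * \<beta> < real_of_int q" using q by (simp add: \<beta>_def)
  hence N: "int N < q" unfolding N_def using \<beta> by (simp add: floor_less_iff)
  have co: "coprime q q'" using coprime_cf_q_pred[OF irr, of "Suc k"] by (simp add: q_def q'_def)
  have nonint: "real j / \<beta> \<notin> \<int>" if j: "j \<in> {1..N}" for j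
  proof
    assume "real j / \<beta> \<in> \<int>"
    hence "(of_int (int j * q') / of_int q :: real) \<in> \<int>" by (simp add: \<beta>_def)
    hence "q dvd int j" using co q by (subst (asm) of_int_divide_in_Ints_iff) (auto simp: coprime_dvd_mult_left_iff)
    hence "q \<le> int j" using j by (intro zdvd_imp_le) auto
    thus False using j N by simp
  qed
  have eq: "saw (real j / \<beta>) = saw (real j * (of_int (cf_q_pred \<alpha> k) / of_int q))" for j
  proof -
    have "real j / \<beta> = real j * (of_int (cf_q_pred \<alpha> k) / of_int q) + of_int (int j * a)"
      using q by (simp add: \<beta>_def rec field_simps)
    thus ?thesis by (simp only: saw_add_of_int)
  qed
  define T where "T = (\<Sum>m=1..M. saw (real m * \<beta>) / real m)"
  define T' where "T' = (\<Sum>j=1..N. saw (real j / \<beta>) / real j)"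
  have T': "\<bar>T'\<bar> \<le> 33 * cf_log_sum \<alpha> k" unfolding T'_def eq using Suc.IH[of N] N by (simp add: q_def)
  \<comment> \<open>Since \<open>q_(k-1) <= q_k\<close>, the slope is \<open>1 / a\<close> up to a
    factor 2, and \<open>ln 2\<close> is absorbed into the 1 of \<open>1 + ln a\<close>.\<close>
  have "1 / \<beta> \<le> 2 * of_int a"
  proof -
    have "cf_q_pred \<alpha> k \<le> 1 * q" using cf_q_pred_le[OF irr, of k] by (simp add: q_def)
    also have "\<dots> \<le> a * q" using a q by (intro mult_right_mono) auto
    finally have "q' \<le> 2 * a * q" by (simp add: rec)
    hence "real_of_int q' \<le> of_int (2 * a * q)" by (simp only: of_int_le_iff)
    thus ?thesis using q by (simp add: \<beta>_def field_simps)
  qed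
  hence "ln (1 / \<beta>) \<le> ln (2 * of_int a)" using \<beta> a by (subst ln_le_cancel_iff) (auto intro: less_le_trans[of 0 "1 / \<beta>"])
  hence "- ln \<beta> \<le> ln 2 + ln (of_int a)" using a \<beta> by (simp add: ln_div ln_mult)
  hence l: "- ln \<beta> \<le> 1 + ln (of_int a)" using ln_2_less_1 by linarith
  have la: "0 \<le> ln (real_of_int a)" using a by simp
  have "\<bar>T + \<beta> * T'\<bar> \<le> 32 - ln \<beta> / 2"
    unfolding T_def T'_def by (rule saw_sum_reciprocity[OF \<beta> N_def nonint])
  moreover have "\<bar>\<beta> * T'\<bar> \<le> \<beta> * (33 * cf_log_sum \<alpha> k)"
    using \<beta> T' by (simp add: abs_mult)
  ultimately have "\<bar>T\<bar> \<le> (32 - ln \<beta> / 2) + \<beta> * (33 * cf_log_sum \<alpha> k)" by linarith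
  \<comment> \<open>Here \<open>32 + (1 + ln a) / 2\<close> is at most
    \<open>33 * (1 + ln a)\<close>, as \<open>ln a\<close> is nonnegative.\<close>
  also have "\<dots> \<le> \<beta> * (33 * cf_log_sum \<alpha> k) + 33 * (1 + ln (of_int a))" using l la by simp
  also have "\<dots> = 33 * cf_log_sum \<alpha> (Suc k)"
    using q unfolding cf_log_sum_def q_def[symmetric] q'_def[symmetric] a_def
    by (simp add: \<beta>_def q'_def[symmetric] field_simps)
  finally show ?case by (simp add: T_def \<beta>_def q_def q'_def)
qed

text \<open>The denominators grow at least like Fibonacci numbers. The stronger bound
  \<open>2 * q_k + q_(k-1)\<close> is inductive, its step being exactly
  \<open>q_k + q_(k-1) <= q_(k+1)\<close>.\<close>

lemma sum_cf_q_le: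
  assumes "\<alpha> \<notin> \<rat>"
  shows "(\<Sum>l=1..k. cf_q \<alpha> l) \<le> 3 * cf_q \<alpha> k"
proof -
  have "(\<Sum>l=1..k. cf_q \<alpha> l) \<le> 2 * cf_q \<alpha> k + cf_q_pred \<alpha> k"
  proof (induction k)
    case (Suc k)
    thus ?case using cf_q_Suc_ge[OF assms, of k] by simp
  qed (auto simp: cf_q_pred_def)
  thus ?thesis using cf_q_pred_le[OF assms, of k] by simp
qed

lemma cf_log_sum_nonneg:
  assumes irr: "\<alpha> \<notin> \<rat>"
  shows "0 \<le> cf_log_sum \<alpha> k"
  unfolding cf_log_sum_def
proof (intro divide_nonneg_nonneg sum_nonneg mult_nonneg_nonneg)
  show "0 \<le> real_of_int (cf_q \<alpha> l)" for l using cf_q_pos[OF irr, of l] by simp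
  show "0 \<le> 1 + ln (real_of_int (cf_a \<alpha> l))" if "l \<in> {1..k}" for l
    using cf_a_ge_1[OF irr, of l] that by simp
qed (use cf_q_pos[OF irr, of k] in auto)

text \<open>For the statement about subsequences: with all logarithms replaced by the largest one,
  the weights \<open>q_l / q_k\<close> sum to at most 3.\<close>

lemma cf_log_sum_le_Max:
  assumes irr: "\<alpha> \<notin> \<rat>" and k: "k \<ge> 1"
  shows "cf_log_sum \<alpha> k \<le> 3 * (1 + ln (of_int (Max (cf_a \<alpha> ` {1..k}))))"
proof -
  define A where "A = Max (cf_a \<alpha> ` {1..k})"
  have A: "cf_a \<alpha> l \<le> A" if "l \<in> {1..k}" for l unfolding A_def using that by (intro Max_ge) auto
  have "1 \<le> A" using A[of 1] cf_a_ge_1[OF irr, of 1] k by simp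
  have "(\<Sum>l=1..k. of_int (cf_q \<alpha> l) * (1 + ln (of_int (cf_a \<alpha> l)))) \<le> (\<Sum>l=1..k. real_of_int (cf_q \<alpha> l) * (1 + ln (of_int A)))"
  proof (intro sum_mono mult_left_mono add_left_mono)
    fix l assume l: "l \<in> {1..k}"
    show "0 \<le> real_of_int (cf_q \<alpha> l)" using cf_q_pos[OF irr, of l] by simp
    show "ln (real_of_int (cf_a \<alpha> l)) \<le> ln (of_int A)"
      using A[OF l] cf_a_ge_1[OF irr, of l] l by simp
  qed
  also have "\<dots> = of_int (\<Sum>l=1..k. cf_q \<alpha> l) * (1 + ln (of_int A))" by (simp add: sum_distrib_right)
  also have "\<dots> \<le> of_int (3 * cf_q \<alpha> k) * (1 + ln (of_int A))"
    using sum_cf_q_le[OF irr, of k] \<open>1 \<le> A\<close> by (intro mult_right_mono) (simp_all only: of_int_le_iff, simp)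
  finally show ?thesis using cf_q_pos[OF irr, of k] by (simp add: cf_log_sum_def A_def field_simps)
qed

text \<open>For the statement about the full sequence: for \<open>l < k\<close> the hypothesis gives
  \<open>q_l * (1 + ln a_l) <= B * a_(l+1) * q_l <= B * q_(l+1)\<close>, so only \<open>a_k\<close>
  keeps its logarithm.\<close>

lemma cf_log_sum_le_last:
  assumes irr: "\<alpha> \<notin> \<rat>" and k: "k \<ge> 1"
    and B: "\<And>l. l \<ge> 1 \<Longrightarrow> 1 + ln (of_int (cf_a \<alpha> l)) \<le> B * of_int (cf_a \<alpha> (Suc l))"
  shows "cf_log_sum \<alpha> k \<le> 1 + ln (of_int (cf_a \<alpha> k)) + 3 * B"
proof -
  obtain j where j: "k = Suc j" using k by (cases k) auto
  have "0 \<le> 1 + ln (real_of_int (cf_a \<alpha> 1))" using cf_a_ge_1[OF irr, of 1] by simp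
  hence "0 \<le> B * of_int (cf_a \<alpha> (Suc 1))" using B[of 1] by linarith
  hence B0: "0 \<le> B" using cf_a_Suc_ge_1[OF irr, of 1] by (simp add: zero_le_mult_iff)
  have "(\<Sum>l=1..j. of_int (cf_q \<alpha> l) * (1 + ln (of_int (cf_a \<alpha> l)))) \<le> (\<Sum>l=1..j. B * real_of_int (cf_q \<alpha> (Suc l)))"
  proof (intro sum_mono)
    fix l assume l: "l \<in> {1..j}"
    have q: "0 \<le> real_of_int (cf_q \<alpha> l)" using cf_q_pos[OF irr, of l] by simp
    have "of_int (cf_q \<alpha> l) * (1 + ln (of_int (cf_a \<alpha> l))) \<le> of_int (cf_q \<alpha> l) * (B * of_int (cf_a \<alpha> (Suc l)))"
      using l q by (intro mult_left_mono B) auto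
    also have "\<dots> = B * of_int (cf_a \<alpha> (Suc l) * cf_q \<alpha> l)" by simp
    also have "\<dots> \<le> B * of_int (cf_q \<alpha> (Suc l))"
      using B0 cf_q_pred_nonneg[OF irr, of l] by (intro mult_left_mono) (auto simp: cf_q_Suc[of _ l] simp del: of_int_mult)
    finally show "of_int (cf_q \<alpha> l) * (1 + ln (of_int (cf_a \<alpha> l))) \<le> B * real_of_int (cf_q \<alpha> (Suc l))" .
  qed
  also have "\<dots> = B * (\<Sum>l=Suc 1..Suc j. real_of_int (cf_q \<alpha> l))" 
    by (simp only: sum_distrib_left[symmetric] sum.shift_bounds_cl_Suc_ivl)
  also have "\<dots> \<le> B * (\<Sum>l=1..k. real_of_int (cf_q \<alpha> l))"
    using B0 less_imp_le[OF cf_q_pos[OF irr]] unfolding j by (intro mult_left_mono sum_mono2) auto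
  also have "\<dots> \<le> B * of_int (3 * cf_q \<alpha> k)"
    using sum_cf_q_le[OF irr, of k] B0 unfolding of_int_sum[symmetric] by (intro mult_left_mono) (simp_all only: of_int_le_iff)
  finally have "(\<Sum>l=1..k. of_int (cf_q \<alpha> l) * (1 + ln (of_int (cf_a \<alpha> l)))) \<le> B * of_int (3 * cf_q \<alpha> k) + of_int (cf_q \<alpha> k) * (1 + ln (of_int (cf_a \<alpha> k)))"
    unfolding j by simp
  thus ?thesis using cf_q_pos[OF irr, of k] by (simp add: cf_log_sum_def field_simps)
qed

section \<open>Perturbed sine products\<close>

lemma prod_diff_roots_unity:
  fixes z :: complex
  assumes "n > 0"
  shows "(\<Prod>k<n. z - cis (2 * pi * real k / real n)) = z ^ n - 1"
proof -
  define A where "A = {z :: complex. z ^ n = 1}"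
  have A: "finite A" "card A = n" using assms by (simp_all add: A_def finite_roots_unity card_roots_unity_eq)
  have deg: "degree (\<Prod>r\<in>A. [:- r, 1:]) = n" using A by (subst degree_prod_eq_sum_degree) auto
  have "(\<Prod>r\<in>A. [:- r, 1:]) = monom 1 n - 1"
  \<comment> \<open>Equal coefficients at \<open>n\<close> leave a difference of degree below
    \<open>n\<close>, so agreement at the \<open>n\<close> roots of unity suffices.\<close>
  proof (rule poly_eqI_degree_lead_coeff[where n = n and A = A])
    have "lead_coeff (\<Prod>r\<in>A. [:- r, 1:]) = 1" by (simp add: lead_coeff_prod)
    thus "coeff (\<Prod>r\<in>A. [:- r, 1:]) n = coeff (monom 1 n - 1) n" using deg assms by simp
    show "degree (monom 1 n - 1 :: complex poly) \<le> n" by (intro degree_diff_le degree_monom_le) auto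
    show "poly (\<Prod>r\<in>A. [:- r, 1:]) z = poly (monom 1 n - 1) z" if "z \<in> A" for z
      using that A by (auto simp: poly_prod poly_monom A_def)
  qed (use A deg in auto)
  hence "poly (\<Prod>r\<in>A. [:- r, 1:]) z = z ^ n - 1" by (simp add: poly_monom)
  also have "poly (\<Prod>r\<in>A. [:- r, 1:]) z = (\<Prod>r\<in>A. z - r)" by (simp add: poly_prod)
  also have "\<dots> = (\<Prod>k<n. z - cis (2 * pi * real k / real n))"
    unfolding A_def by (rule prod.reindex_bij_betw[OF Complex.bij_betw_roots_unity[OF assms], symmetric])
  finally show ?thesis .
qed

lemma norm_cis_diff: "norm (cis a - cis b) = \<bar>2 * sin ((a - b) / 2)\<bar>"
proof -
  have "(norm (cis a - cis b))\<^sup>2 = (cos a - cos b)\<^sup>2 + (sin a - sin b)\<^sup>2" by (simp add: cmod_power2)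
  also have "\<dots> = ((cos a)\<^sup>2 + (sin a)\<^sup>2) + ((cos b)\<^sup>2 + (sin b)\<^sup>2) - 2 * (cos a * cos b + sin a * sin b)"
    by (simp only: power2_eq_square algebra_simps)
  also have "\<dots> = 2 - 2 * cos (a - b)" by (simp add: cos_diff)
  also have "\<dots> = \<bar>2 * sin ((a - b) / 2)\<bar>\<^sup>2"
    using cos_double_sin[of "(a - b) / 2"] by (simp add: power_mult_distrib diff_divide_distrib algebra_simps)
  finally show ?thesis by (rule power2_eq_imp_eq) auto
qed

text \<open>The factors are the distances from the point \<open>z\<close> of the unit circle to the
  \<open>q\<close>-th roots of unity, so the product is the modulus of
  \<open>z ^ q - 1\<close>.\<close>

lemma prod_sin_shifted:
  assumes "q > 0"
  shows "(\<Prod>i<q. \<bar>2 * sin (pi * (real i + s) / real q)\<bar>) = \<bar>2 * sin (pi * s)\<bar>"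
proof -
  define z where "z = cis (- 2 * pi * s / real q)"
  have "(\<Prod>i<q. \<bar>2 * sin (pi * (real i + s) / real q)\<bar>) = (\<Prod>i<q. norm (z - cis (2 * pi * real i / real q)))"
  proof (rule prod.cong[OF refl])
    fix i
    have "(- 2 * pi * s / real q - 2 * pi * real i / real q) / 2 = - (pi * (real i + s) / real q)"
      using assms by (simp add: field_simps)
    thus "\<bar>2 * sin (pi * (real i + s) / real q)\<bar> = norm (z - cis (2 * pi * real i / real q))"
      unfolding z_def norm_cis_diff by (simp only: sin_minus abs_minus_cancel mult_minus_right)
  qed
  also have "\<dots> = norm (z ^ q - 1)" by (simp only: prod_norm prod_diff_roots_unity[OF assms])
  also have "z ^ q = cis (- 2 * pi * s)" using assms by (simp add: z_def Complex.DeMoivre)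
  also have "norm (cis (- 2 * pi * s) - 1) = \<bar>2 * sin (pi * s)\<bar>"
    using norm_cis_diff[of "- 2 * pi * s" 0] by simp
  finally show ?thesis .
qed

section \<open>Estimates for sine, cotangent and the logarithm of the sine\<close>

text \<open>The range up to 2 is what the crude bound \<open>pi < 4\<close> provides for arguments
  up to \<open>pi / 2\<close>.\<close>

lemma sin_ge_third:
  assumes "0 \<le> x" "x \<le> (2 :: real)"
  shows "x / 3 \<le> sin x"
proof -
  have "\<bar>sin x - x\<bar> \<le> x ^ 3 / 6"
    using Maclaurin_sin_bound[of x 3] assms by (simp add: sin_coeff_def numeral_3_eq_3 field_simps)
  also have "x ^ 3 = x * (x * x)" by (simp add: power3_eq_cube)
  also have "x * (x * x) / 6 \<le> x * (2 * 2) / 6"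
    using assms by (intro divide_right_mono mult_left_mono mult_mono) auto
  finally show ?thesis by linarith
qed

text \<open>Here \<open>d\<close> bounds from below the distance of \<open>t\<close> to the zeros at
  0 and \<open>q\<close>. The symmetry of \<open>t\<close> and \<open>q - t\<close> reduces to
  \<open>t <= q / 2\<close>, where \<open>pi > 3\<close> compensates the 1/3 of
  \<open>sin_ge_third\<close>.\<close>

lemma sin_pi_div_ge:
  assumes "0 \<le> d" "d \<le> t" "d \<le> q - t" "0 < (q :: real)"
  shows "d / q \<le> sin (pi * t / q)"
proof -
  have *: "d / q \<le> sin (pi * t / q)" if "0 \<le> t" "t \<le> q / 2" "d \<le> t" for t
  proof -
    have "pi * t / q \<le> 4 * (q / 2) / q"
      using that assms pi_less_4 by (intro divide_right_mono mult_mono) auto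
    hence "pi * t / q / 3 \<le> sin (pi * t / q)" using that assms by (intro sin_ge_third) auto
    moreover have "3 * t / q \<le> pi * t / q" using that assms pi_gt3 by (intro divide_right_mono mult_right_mono) auto
    moreover have "d / q \<le> t / q" using that assms by (intro divide_right_mono) auto
    ultimately show ?thesis by simp
  qed
  show ?thesis
  proof (cases "t \<le> q / 2")
    case True
    thus ?thesis using assms by (intro *) auto
  next
    case False
    have "sin (pi * t / q) = sin (pi - pi * t / q)" by simp
    also have "pi - pi * t / q = pi * (q - t) / q" using assms by (simp add: field_simps)
    also have "d / q \<le> sin (pi * (q - t) / q)" using assms False by (intro *) auto
    finally show ?thesis .
  qed
qed

text \<open>The partial fraction expansion of the cotangent with only its poles at 0 and 1 kept. On
  the left half the pole at 0 leaves at most 24 and the other term is at most 2; reflection gives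
  the right half.\<close>

lemma pi_cot_approx:
  assumes "0 < z" "z < (1 :: real)"
  shows "\<bar>pi * cot (pi * z) - 1 / z + 1 / (1 - z)\<bar> \<le> 26"
proof -
  have *: "\<bar>pi * cot (pi * z) - 1 / z + 1 / (1 - z)\<bar> \<le> 26" if z: "0 < z" "z \<le> 1/2" for z
  proof -
    define y where "y = pi * z"
    have "pi * z \<le> 4 * (1/2)" using z pi_less_4 by (intro mult_mono) auto
    hence y: "0 < y" "y \<le> 2" using z by (auto simp: y_def)
    have s: "y / 3 \<le> sin y" using y by (intro sin_ge_third) auto
    have s0: "0 < sin y" using s y by linarith
    have "\<bar>sin y - y\<bar> \<le> y ^ 3 / 6"
      using Maclaurin_sin_bound[of y 3] y by (simp add: sin_coeff_def numeral_3_eq_3 field_simps)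
    moreover have "\<bar>cos y - 1\<bar> \<le> y\<^sup>2 / 2"
    proof -
      have "cos y = 1 - 2 * (sin (y / 2))\<^sup>2" using cos_double_sin[of "y / 2"] by simp
      moreover have "(sin (y / 2))\<^sup>2 \<le> (y / 2)\<^sup>2" using abs_sin_x_le_abs_x[of "y / 2"] by (simp only: abs_le_square_iff)
      ultimately show ?thesis by (simp add: power_divide)
    qed
    hence "y * \<bar>cos y - 1\<bar> \<le> y * (y\<^sup>2 / 2)" using y by (intro mult_left_mono) auto
    hence "\<bar>y * cos y - y\<bar> \<le> y ^ 3 / 2"
      using y by (simp add: abs_mult[symmetric] right_diff_distrib power2_eq_square power3_eq_cube)
    \<comment> \<open>\<open>sin y\<close> and \<open>y * cos y\<close> agree to third order, so
      division by \<open>y * sin y\<close> leaves a quantity of order \<open>y\<close>.\<close>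
    ultimately have n: "\<bar>y * cos y - sin y\<bar> \<le> y ^ 3" using zero_le_power[of y 3] y by linarith
    have "pi * cot (pi * z) - 1 / z = pi * ((y * cos y - sin y) / (y * sin y))"
      using z s0 y by (simp add: y_def cot_def field_simps)
    hence "\<bar>pi * cot (pi * z) - 1 / z\<bar> = pi * (\<bar>y * cos y - sin y\<bar> / (y * sin y))"
      using y s0 by (simp add: abs_mult abs_divide)
    also have "\<dots> \<le> 4 * (y ^ 3 / (y * (y / 3)))"
      using y s n s0 pi_less_4 by (intro mult_mono frac_le) auto
    also have "\<dots> = 12 * y" using y by (simp add: field_simps power3_eq_cube)
    also have "\<dots> \<le> 24" using y by simp
    finally have "\<bar>pi * cot (pi * z) - 1 / z\<bar> \<le> 24" .
    moreover have "\<bar>1 / (1 - z)\<bar> \<le> 2" using z by (simp add: field_simps)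
    ultimately show ?thesis by linarith
  qed
  show ?thesis
  proof (cases "z \<le> 1/2")
    case False
    have "cot (pi * (1 - z)) = - cot (pi * z)"
      by (simp add: cot_def right_diff_distrib sin_diff cos_diff)
    thus ?thesis using *[of "1 - z"] assms False by simp
  qed (use assms * in auto)
qed

text \<open>From \<open>cot a - cot b = sin (b - a) / (sin a * sin b)\<close>; all powers of
  \<open>q\<close> cancel, and 16 is the square of the bound 4 for \<open>pi\<close>.\<close>

lemma cot_diff_le:
  fixes q t u d e :: real
  assumes "0 < d" "d \<le> t" "d \<le> q - t" "0 < e" "e \<le> u" "e \<le> q - u"
  shows "\<bar>pi / q * cot (pi * t / q) - pi / q * cot (pi * u / q)\<bar> \<le> 16 * \<bar>t - u\<bar> / (d * e)"
proof -
  have q: "0 < q" using assms by linarith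
  have s: "d / q \<le> sin (pi * t / q)" "e / q \<le> sin (pi * u / q)"
    using assms q by (auto intro!: sin_pi_div_ge)
  have s0: "0 < d / q" "0 < e / q" using assms q by auto
  define a b where "a = pi * t / q" and "b = pi * u / q"
  have sab: "0 < sin a" "0 < sin b" using s s0 unfolding a_def b_def by linarith+
  have "pi / q * cot a - pi / q * cot b = pi / q * (sin (b - a) / (sin a * sin b))"
    using sab q by (simp add: cot_def sin_diff field_simps)
  hence "\<bar>pi / q * cot a - pi / q * cot b\<bar> = pi / q * (\<bar>sin (b - a)\<bar> / (sin a * sin b))"
    using sab q by (simp add: abs_mult abs_divide)
  also have "\<dots> \<le> 4 / q * ((4 * \<bar>t - u\<bar> / q) / (d / q * (e / q)))"
  proof (intro mult_mono frac_le)
    have "b - a = pi / q * (u - t)" by (simp add: a_def b_def algebra_simps diff_divide_distrib)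
    hence "\<bar>sin (b - a)\<bar> \<le> pi / q * \<bar>t - u\<bar>" using abs_sin_x_le_abs_x[of "b - a"] q
      by (simp add: abs_mult abs_minus_commute)
    also have "\<dots> \<le> 4 / q * \<bar>t - u\<bar>" using q pi_less_4 by (intro mult_right_mono divide_right_mono) auto
    finally show "\<bar>sin (b - a)\<bar> \<le> 4 * \<bar>t - u\<bar> / q" by simp
  qed (use assms q pi_less_4 s s0 sab in \<open>auto simp: a_def b_def intro!: divide_right_mono\<close>)
  also have "\<dots> = 16 * \<bar>t - u\<bar> / (d * e)" using q assms by (simp add: field_simps)
  finally show ?thesis by (simp add: a_def b_def)
qed

text \<open>The mean value theorem gives the cotangent at an intermediate point, which
  \<open>cot_diff_le\<close> then moves to \<open>i\<close>. Evaluating at \<open>i\<close> rather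
  than \<open>i + s\<close> makes the resulting cotangent sum independent of the shift
  \<open>s\<close>.\<close>

lemma ln_sin_perturb:
  fixes q i s e :: real
  assumes "1 \<le> i" "i \<le> q - 1" "\<bar>s\<bar> \<le> 1/2" "\<bar>e\<bar> \<le> 1/4"
  shows "\<bar>ln (sin (pi * (i + s + e) / q)) - ln (sin (pi * (i + s) / q)) - e * (pi / q * cot (pi * i / q))\<bar>
         \<le> 48 * \<bar>e\<bar> * (1 / i\<^sup>2 + 1 / (q - i)\<^sup>2)"
proof -
  define m where "m = min i (q - i)"
  have q: "q > 0" using assms by linarith
  have m: "1 \<le> m" "m \<le> i" "m \<le> q - i" using assms by (auto simp: m_def)
  define f where "f t = ln (sin (pi * t / q))" for t
  define g where "g t = pi / q * cot (pi * t / q)" for t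
  have pos: "0 < sin (pi * t / q)" if "\<bar>t - i\<bar> \<le> 3/4" for t
  proof (rule less_le_trans)
    show "0 < (1/4) / q" using q by simp
    show "(1/4) / q \<le> sin (pi * t / q)"
      using that m q unfolding abs_le_iff by (intro sin_pi_div_ge) linarith+
  qed
  have deriv: "(f has_real_derivative g t) (at t)" if "\<bar>t - i\<bar> \<le> 3/4" for t
    unfolding f_def g_def using pos[OF that] q
    by (auto intro!: derivative_eq_intros simp: cot_def field_simps)
  obtain x where x: "\<bar>x - i\<bar> \<le> 3/4" "f (i + s + e) - f (i + s) = e * g x"
  proof (cases e "0 :: real" rule: linorder_cases)
    case less
    have "\<exists>z. i + s + e < z \<and> z < i + s \<and> f (i + s) - f (i + s + e) = (i + s - (i + s + e)) * g z"
      using less assms by (intro MVT2 deriv) linarith+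
    then obtain z where "i + s + e < z" "z < i + s" "f (i + s) - f (i + s + e) = (i + s - (i + s + e)) * g z" by blast
    moreover from this have "\<bar>z - i\<bar> \<le> 3/4" using assms by linarith
    ultimately show ?thesis by (intro that[of z]) (auto simp: algebra_simps)
  next
    case greater
    have "\<exists>z. i + s < z \<and> z < i + s + e \<and> f (i + s + e) - f (i + s) = (i + s + e - (i + s)) * g z"
      using greater assms by (intro MVT2 deriv) linarith+
    then obtain z where "i + s < z" "z < i + s + e" "f (i + s + e) - f (i + s) = (i + s + e - (i + s)) * g z" by blast
    moreover from this have "\<bar>z - i\<bar> \<le> 3/4" using assms by linarith
    ultimately show ?thesis by (intro that[of z]) (auto simp: algebra_simps)
  qed (use that[of i] in auto)
  \<comment> \<open>As \<open>m >= 1\<close>, the point \<open>x\<close> stays at distance at least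
    \<open>m - 3/4 >= m / 4\<close> from 0 and \<open>q\<close>.\<close>
  have "\<bar>g x - g i\<bar> \<le> 16 * \<bar>x - i\<bar> / (m / 4 * m)"
    unfolding g_def using x(1) m by (intro cot_diff_le) linarith+
  also have "\<dots> \<le> 16 * (3/4) / (m / 4 * m)" using x m by (intro divide_right_mono) auto
  also have "\<dots> = 48 * (1 / m\<^sup>2)" using m by (simp add: field_simps power2_eq_square)
  also have "1 / m\<^sup>2 \<le> 1 / i\<^sup>2 + 1 / (q - i)\<^sup>2" by (auto simp: m_def min_def)
  finally have "\<bar>g x - g i\<bar> \<le> 48 * (1 / i\<^sup>2 + 1 / (q - i)\<^sup>2)" by simp
  hence "\<bar>e\<bar> * \<bar>g x - g i\<bar> \<le> \<bar>e\<bar> * (48 * (1 / i\<^sup>2 + 1 / (q - i)\<^sup>2))" by (intro mult_left_mono) auto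
  also have "\<bar>e\<bar> * \<bar>g x - g i\<bar> = \<bar>f (i + s + e) - f (i + s) - e * g i\<bar>"
    by (simp add: x abs_mult[symmetric] right_diff_distrib)
  finally show ?thesis by (simp add: f_def g_def mult_ac)
qed

text \<open>Abel summation: in the difference quotient the weight of \<open>w (c + j)\<close> is \<open>1 / (j * (j - 1))\<close>.\<close>

lemma sum_over_index_shift_1:
  fixes w :: "int \<Rightarrow> real"
  assumes "\<And>m. \<bar>w m\<bar> \<le> 1/2"
  shows "\<bar>(\<Sum>i=1..n. w (c + 1 + int i) / real i) - (\<Sum>i=1..n. w (c + int i) / real i)\<bar> \<le> 1"
proof (cases "n = 0")
  case False
  \<comment> \<open>The last term removes the boundary contribution at the upper end; the one at the
    lower end is \<open>- w (c + 1)\<close>. Together with both, the bounds add up to exactly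
    1.\<close>
  define U where "U n = (\<Sum>i=1..n. w (c + 1 + int i) / real i) - (\<Sum>i=1..n. w (c + int i) / real i)
    - w (c + int n + 1) / real n" for n
  have "n \<ge> 1" using False by simp
  hence "\<bar>U n + w (c + 1)\<bar> \<le> 1/2 - 1 / (2 * real n)"
  proof (induction n rule: nat_induct_at_least)
    case base
    thus ?case by (simp add: U_def add_ac)
  next
    case (Suc n)
    define d where "d = 1 / real n - 1 / real (Suc n)"
    have d: "0 \<le> d" using Suc.hyps by (simp add: d_def field_simps)
    have "U (Suc n) = U n + w (c + int n + 1) * d"
      using Suc.hyps by (simp add: U_def d_def add_ac right_diff_distrib)
    moreover have "\<bar>w (c + int n + 1) * d\<bar> \<le> 1/2 * d"
      unfolding abs_mult using d by (intro mult_mono assms) auto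
    moreover have "1/2 - 1 / (2 * real n) + 1/2 * d = 1/2 - 1 / (2 * real (Suc n))" by (simp add: d_def diff_divide_distrib)
    ultimately show ?case using Suc.IH by linarith
  qed
  moreover have "\<bar>w (c + int n + 1) / real n\<bar> \<le> 1 / (2 * real n)"
    using assms[of "c + int n + 1"] False by (simp add: field_simps)
  moreover have "\<bar>w (c + 1)\<bar> \<le> 1/2" by (rule assms)
  ultimately show ?thesis unfolding U_def by linarith
qed auto

text \<open>Iterated unit shifts in either direction. The cost does not depend on \<open>n\<close>;
  in the application \<open>c\<close> is the rounding of the argument, bounded on compact
  sets.\<close>

lemma sum_over_index_shift:
  fixes w :: "int \<Rightarrow> real"
  assumes "\<And>m. \<bar>w m\<bar> \<le> 1/2"
  shows "\<bar>(\<Sum>i=1..n. w (c + int i) / real i) - (\<Sum>i=1..n. w (int i) / real i)\<bar> \<le> \<bar>of_int c\<bar>"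
proof -
  define A where "A c = (\<Sum>i=1..n. w (c + int i) / real i)" for c
  have step: "\<bar>A (c + 1) - A c\<bar> \<le> 1" for c
    unfolding A_def by (rule sum_over_index_shift_1) (rule assms)
  have "\<bar>A c - A 0\<bar> \<le> \<bar>of_int c\<bar>"
  proof (induction c rule: int_induct[where k = 0])
    case (step1 i)
    thus ?case using step[of i] by simp
  next
    case (step2 i)
    thus ?case using step[of "i - 1"] by simp
  qed auto
  thus ?thesis by (simp add: A_def)
qed

section \<open>Comparison of the perturbed with the unperturbed product\<close>

lemma abs_exp_minus_1_le:
  assumes "\<bar>x\<bar> \<le> (1 :: real)"
  shows "\<bar>exp x - 1\<bar> \<le> 2 * \<bar>x\<bar>"
proof (cases "x \<ge> 0")
  case True
  have "x\<^sup>2 \<le> x" using True assms by (simp add: power2_eq_square mult_left_le)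
  thus ?thesis using exp_bound[of x] True assms exp_ge_add_one_self[of x] by simp
next
  case False
  hence "exp x \<le> 1" by simp
  thus ?thesis using exp_ge_add_one_self[of x] False by linarith
qed

text \<open>The full product is at most \<open>2 * pi * \<bar>s\<bar>\<close> in size, while its
  factor at \<open>i = 0\<close> is at least \<open>2 * \<bar>s\<bar> / q\<close>.\<close>

lemma prod_sin_tail_le:
  assumes q: "q > 0" and "\<bar>s\<bar> \<le> 1/2"
  shows "(\<Prod>i=1..<q. \<bar>2 * sin (pi * (real i + s) / real q)\<bar>) \<le> 4 * real q"
proof -
  define G where "G s = (\<Prod>i=1..<q. \<bar>2 * sin (pi * (real i + s) / real q)\<bar>)" for s
  have "{..<q} = insert 0 {1..<q}" using q by auto
  hence split: "\<bar>2 * sin (pi * s / real q)\<bar> * G s = \<bar>2 * sin (pi * s)\<bar>" for s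
    using prod_sin_shifted[OF q, of s] by (simp add: G_def)
  have nz: "G s \<le> 4 * real q" if s: "\<bar>s\<bar> \<le> 1/2" "s \<noteq> 0" for s
  proof -
    have "\<bar>s\<bar> / real q \<le> sin (pi * \<bar>s\<bar> / real q)" using s q by (intro sin_pi_div_ge) auto
    also have "sin (pi * \<bar>s\<bar> / real q) \<le> \<bar>sin (pi * s / real q)\<bar>" by (cases "s \<ge> 0") auto
    finally have l: "\<bar>s\<bar> / real q \<le> \<bar>sin (pi * s / real q)\<bar>" .
    have "0 \<le> G s" by (simp add: G_def prod_nonneg)
    hence "\<bar>s\<bar> / real q * G s \<le> \<bar>sin (pi * s / real q)\<bar> * G s" using l by (intro mult_right_mono)
    also have "\<dots> = \<bar>sin (pi * s)\<bar>" using split[of s] by (simp add: abs_mult)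
    also have "\<dots> \<le> pi * \<bar>s\<bar>" using abs_sin_x_le_abs_x[of "pi * s"] by (simp add: abs_mult)
    also have "\<dots> \<le> 4 * \<bar>s\<bar>" using pi_less_4 by (intro mult_right_mono) auto
    finally show ?thesis using s q by (simp add: field_simps)
  qed
  \<comment> \<open>\<open>split\<close> is void at \<open>s = 0\<close>, so the bound is extended there by continuity.\<close>
  have "G 0 \<le> 4 * real q"
  proof (rule tendsto_upperbound)
    show "(G \<longlongrightarrow> G 0) (at 0)" unfolding G_def by (intro tendsto_intros) (use q in auto)
    show "eventually (\<lambda>s. G s \<le> 4 * real q) (at 0)"
      unfolding eventually_at by (intro exI[of _ "1/2"]) (auto intro!: nz)
  qed auto
  thus ?thesis using nz[of s] assms(2) unfolding G_def by (cases "s = 0") auto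
qed

lemma abs_two_sin_lipschitz:
  fixes u v :: real
  shows "\<bar>\<bar>2 * sin u\<bar> - \<bar>2 * sin v\<bar>\<bar> \<le> 2 * \<bar>u - v\<bar>"
proof -
  have "\<bar>sin u - sin v\<bar> = 2 * \<bar>sin ((u - v) / 2)\<bar> * \<bar>cos ((u + v) / 2)\<bar>"
    by (subst sin_diff_sin) (simp only: abs_mult abs_numeral)
  also have "\<dots> \<le> 2 * \<bar>(u - v) / 2\<bar> * 1"
    by (intro mult_mono mult_left_mono abs_sin_x_le_abs_x) auto
  finally have "\<bar>sin u - sin v\<bar> \<le> \<bar>u - v\<bar>" by simp
  moreover have "\<bar>2 * sin u - 2 * sin v\<bar> = 2 * \<bar>sin u - sin v\<bar>"
    by (simp only: right_diff_distrib[symmetric] abs_mult abs_numeral)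
  ultimately have "\<bar>2 * sin u - 2 * sin v\<bar> \<le> 2 * \<bar>u - v\<bar>" by simp
  with abs_triangle_ineq3 show ?thesis by (rule order_trans)
qed

text \<open>The factor at \<open>i = 0\<close> may vanish and is compared directly. The others are
  positive, and the logarithm \<open>L\<close> of their ratio is treated by
  \<open>ln_sin_perturb\<close>, at a cost of 96, and by \<open>pi_cot_approx\<close>, at a cost of
  13, which leaves the two weighted sums in the hypothesis on \<open>E\<close>.\<close>

lemma prod_sin_perturb:
  fixes w :: "nat \<Rightarrow> real" and s \<eta> :: real
  assumes q: "q > 0" and w: "\<And>i. \<bar>w i\<bar> \<le> 1/2" and s: "\<bar>s\<bar> \<le> 1/2" and \<eta>: "0 \<le> \<eta>" "\<eta> \<le> 1/2"
    and E: "\<eta> * (109 + \<bar>\<Sum>i=1..<q. w i / real i\<bar> + \<bar>\<Sum>i=1..<q. w i / (real q - real i)\<bar>) \<le> E" "E \<le> 1"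
  shows "\<bar>(\<Prod>i<q. \<bar>2 * sin (pi * (real i + s + \<eta> * w i) / real q)\<bar>) - \<bar>2 * sin (pi * s)\<bar>\<bar> \<le> 64 * E"
proof -
  define S where "S i = \<bar>2 * sin (pi * (real i + s) / real q)\<bar>" for i
  define S' where "S' i = \<bar>2 * sin (pi * (real i + s + \<eta> * w i) / real q)\<bar>" for i
  define g where "g i = pi / real q * cot (pi * real i / real q)" for i
  have e: "\<bar>\<eta> * w i\<bar> \<le> \<eta> / 2" for i
    using mult_left_mono[OF w[of i] \<eta>(1)] \<eta> by (simp add: abs_mult)
  have e4: "\<bar>\<eta> * w i\<bar> \<le> 1/4" for i using e[of i] \<eta> by linarith
  have lnS: "ln (S' i) - ln (S i) = ln (sin (pi * (real i + s + \<eta> * w i) / real q)) - ln (sin (pi * (real i + s) / real q))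
      \<and> 0 < S i \<and> 0 < S' i" if i: "i \<in> {1..<q}" for i
  proof -
    have pos: "0 < sin (pi * t / real q)" if "\<bar>t - real i\<bar> \<le> 3/4" for t
    proof (rule less_le_trans)
      show "0 < (1/4) / real q" using q by simp
      have "1 \<le> real i" "real i \<le> real q - 1" using i by auto
      thus "(1/4) / real q \<le> sin (pi * t / real q)"
        using that q by (intro sin_pi_div_ge) linarith+
    qed
    have "\<bar>real i + s + \<eta> * w i - real i\<bar> \<le> 3/4" using s e4[of i] by linarith
    moreover have "\<bar>real i + s - real i\<bar> \<le> 3/4" using s by linarith
    ultimately have "0 < sin (pi * (real i + s + \<eta> * w i) / real q)" "0 < sin (pi * (real i + s) / real q)"
      by (intro pos; simp)+
    thus ?thesis by (simp add: S_def S'_def ln_mult)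
  qed
  define L where "L = (\<Sum>i=1..<q. ln (S' i) - ln (S i))"
  define b where "b i = 1 / (real i)\<^sup>2 + 1 / (real q - real i)\<^sup>2" for i
  have sb: "(\<Sum>i=1..<q. b i) \<le> 4"
  proof -
    have eq: "{1..<q} = {1..q-1}" using q by auto
    have "(\<Sum>i=1..<q. 1 / (real q - real i)\<^sup>2) = (\<Sum>i=1..<q. 1 / (real i)\<^sup>2)"
      by (rule sum.reindex_bij_witness[of _ "\<lambda>i. q - i" "\<lambda>i. q - i"]) (auto simp: of_nat_diff)
    moreover have "(\<Sum>i=1..<q. 1 / (real i)\<^sup>2) \<le> 2" unfolding eq by (rule sum_inverse_squares_le)
    ultimately show ?thesis by (simp add: b_def sum.distrib)
  qed
  have "\<bar>L - (\<Sum>i=1..<q. \<eta> * w i * g i)\<bar> = \<bar>\<Sum>i=1..<q. ln (S' i) - ln (S i) - \<eta> * w i * g i\<bar>"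
    by (simp add: L_def sum_subtractf)
  also have "\<dots> \<le> (\<Sum>i=1..<q. 24 * \<eta> * b i)"
  proof (rule order_trans[OF sum_abs], intro sum_mono)
    fix i assume i: "i \<in> {1..<q}"
    have "1 \<le> real i" "real i \<le> real q - 1" using i by auto
    hence "\<bar>ln (S' i) - ln (S i) - \<eta> * w i * g i\<bar> \<le> 48 * \<bar>\<eta> * w i\<bar> * b i"
      using ln_sin_perturb[of "real i" "real q" s "\<eta> * w i"] s e4[of i] lnS[OF i] by (simp add: g_def b_def)
    also have "\<dots> \<le> 48 * (\<eta> / 2) * b i" by (intro mult_left_mono mult_right_mono e) (auto simp: b_def)
    finally show "\<bar>ln (S' i) - ln (S i) - \<eta> * w i * g i\<bar> \<le> 24 * \<eta> * b i" by simp
  qed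
  also have "\<dots> \<le> 24 * \<eta> * 4"
    unfolding sum_distrib_left[symmetric] using \<eta> sb by (intro mult_left_mono) auto
  finally have L1: "\<bar>L - (\<Sum>i=1..<q. \<eta> * w i * g i)\<bar> \<le> \<eta> * 96" by simp
  have g: "\<bar>g i - (1 / real i - 1 / (real q - real i))\<bar> \<le> 26 / real q" if i: "i \<in> {1..<q}" for i
  proof -
    define z where "z = real i / real q"
    have z: "0 < z" "z < 1" using i by (auto simp: z_def)
    have "g i - (1 / real i - 1 / (real q - real i)) = (pi * cot (pi * z) - 1 / z + 1 / (1 - z)) / real q"
      using i by (simp add: g_def z_def field_simps)
    thus ?thesis using pi_cot_approx[OF z] q by (simp add: abs_divide divide_right_mono)
  qed
  define A B where "A = (\<Sum>i=1..<q. w i / real i)" and "B = (\<Sum>i=1..<q. w i / (real q - real i))"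
  have "\<bar>(\<Sum>i=1..<q. w i * g i) - (A - B)\<bar> = \<bar>\<Sum>i=1..<q. w i * (g i - (1 / real i - 1 / (real q - real i)))\<bar>"
    by (simp add: A_def B_def sum_subtractf[symmetric] right_diff_distrib)
  also have "\<dots> \<le> (\<Sum>i=1..<q. 1/2 * (26 / real q))"
    by (rule order_trans[OF sum_abs], intro sum_mono, unfold abs_mult, intro mult_mono w g) auto
  also have "\<dots> \<le> 13" using q by (simp add: field_simps of_nat_diff)
  finally have "\<bar>\<Sum>i=1..<q. w i * g i\<bar> \<le> 13 + \<bar>A\<bar> + \<bar>B\<bar>" by linarith
  hence "\<eta> * \<bar>\<Sum>i=1..<q. w i * g i\<bar> \<le> \<eta> * (13 + \<bar>A\<bar> + \<bar>B\<bar>)" using \<eta> by (intro mult_left_mono) auto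
  hence "\<bar>\<Sum>i=1..<q. \<eta> * w i * g i\<bar> \<le> \<eta> * (13 + \<bar>A\<bar> + \<bar>B\<bar>)"
    using \<eta> by (simp add: mult.assoc sum_distrib_left[symmetric] abs_mult)
  hence "\<bar>L\<bar> \<le> \<eta> * 96 + \<eta> * (13 + \<bar>A\<bar> + \<bar>B\<bar>)" using L1 by linarith
  also have "\<dots> \<le> E" using E(1) by (simp add: A_def B_def algebra_simps)
  finally have L: "\<bar>L\<bar> \<le> E" .
  define G where "G = (\<Prod>i=1..<q. S i)"
  define R where "R = exp L"
  have G: "0 \<le> G" "G \<le> 4 * real q"
    unfolding G_def S_def using prod_sin_tail_le[OF q s] by (auto intro!: prod_nonneg)
  have GR: "(\<Prod>i=1..<q. S' i) = G * R"
  proof -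
    have "(\<Prod>i=1..<q. S' i) = (\<Prod>i=1..<q. S i * exp (ln (S' i) - ln (S i)))"
    proof (rule prod.cong[OF refl])
      fix i assume "i \<in> {1..<q}"
      hence "0 < S i" "0 < S' i" using lnS by auto
      thus "S' i = S i * exp (ln (S' i) - ln (S i))" by (simp add: exp_diff)
    qed
    thus ?thesis by (simp add: prod.distrib G_def R_def L_def exp_sum)
  qed
  have "\<bar>R - 1\<bar> \<le> 2 * \<bar>L\<bar>" unfolding R_def using L E by (intro abs_exp_minus_1_le) linarith
  hence R: "\<bar>R - 1\<bar> \<le> 2 * E" using L by linarith
  have ins: "{..<q} = insert 0 {1..<q}" using q by auto
  have P: "(\<Prod>i<q. S' i) = S' 0 * (G * R)" unfolding ins GR[symmetric] by simp
  have Q: "S 0 * G = \<bar>2 * sin (pi * s)\<bar>"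
    using prod_sin_shifted[OF q, of s] unfolding ins G_def S_def by simp
  have lip: "\<bar>2 * sin (pi * u / real q)\<bar> \<le> 8 * \<bar>u\<bar> / real q" for u
  proof -
    have "\<bar>sin (pi * u / real q)\<bar> \<le> pi * \<bar>u\<bar> / real q"
      using abs_sin_x_le_abs_x[of "pi * u / real q"] by (simp add: abs_mult)
    also have "\<dots> \<le> 4 * \<bar>u\<bar> / real q" using pi_less_4 by (intro divide_right_mono mult_right_mono) auto
    finally show ?thesis by (simp add: abs_mult)
  qed
  have S0: "S' 0 \<le> 6 / real q"
  proof -
    have "S' 0 \<le> 8 * \<bar>s + \<eta> * w 0\<bar> / real q" using lip[of "s + \<eta> * w 0"] by (simp add: S'_def)
    also have "\<dots> \<le> 8 * (3/4) / real q" using s e4[of 0] by (intro divide_right_mono mult_left_mono) linarith+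
    finally show ?thesis by simp
  qed
  have S0d: "\<bar>S' 0 - S 0\<bar> \<le> 4 * \<eta> / real q"
  proof -
    have "\<bar>S' 0 - S 0\<bar> \<le> 2 * \<bar>pi * (s + \<eta> * w 0) / real q - pi * s / real q\<bar>"
      using abs_two_sin_lipschitz[of "pi * (s + \<eta> * w 0) / real q" "pi * s / real q"] by (simp add: S'_def S_def)
    also have "pi * (s + \<eta> * w 0) / real q - pi * s / real q = pi * (\<eta> * w 0) / real q"
      by (simp add: distrib_left add_divide_distrib)
    also have "2 * \<bar>pi * (\<eta> * w 0) / real q\<bar> = 2 * (pi * \<bar>\<eta> * w 0\<bar> / real q)" by (simp add: abs_mult)
    also have "\<dots> \<le> 2 * (4 * (\<eta> / 2) / real q)"
      using pi_less_4 e[of 0] by (intro mult_left_mono divide_right_mono mult_mono) auto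
    finally show ?thesis by simp
  qed
  \<comment> \<open>The size \<open>4 * q\<close> of \<open>G\<close> is compensated by the factor
    at \<open>i = 0\<close>, which is \<open>O(1 / q)\<close> and changes by
    \<open>O(\<eta> / q)\<close>.\<close>
  have "S' 0 * (G * R) - S 0 * G = G * S' 0 * (R - 1) + G * (S' 0 - S 0)" by (simp add: algebra_simps)
  hence "\<bar>S' 0 * (G * R) - S 0 * G\<bar> \<le> \<bar>G * S' 0 * (R - 1)\<bar> + \<bar>G * (S' 0 - S 0)\<bar>" by linarith
  also have "\<dots> = G * S' 0 * \<bar>R - 1\<bar> + G * \<bar>S' 0 - S 0\<bar>" using G by (simp add: abs_mult S'_def)
  also have "\<dots> \<le> 4 * real q * (6 / real q) * (2 * E) + 4 * real q * (4 * \<eta> / real q)"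
    using G R S0 S0d by (intro add_mono mult_mono) (auto simp: S'_def)
  also have "\<dots> = 48 * E + 16 * \<eta>" using q by simp
  also have "\<eta> \<le> E"
  proof -
    have "\<eta> * 1 \<le> \<eta> * (109 + \<bar>A\<bar> + \<bar>B\<bar>)" using \<eta> by (intro mult_left_mono) auto
    thus ?thesis using E(1) by (simp add: A_def B_def)
  qed
  finally have "\<bar>S' 0 * (G * R) - S 0 * G\<bar> \<le> 64 * E" by simp
  thus ?thesis using P Q by (simp add: S'_def)
qed

section \<open>The product along a convergent denominator\<close>

text \<open>Supplies the two sums in \<open>prod_sin_perturb\<close>. In the second, reversing
  \<open>i\<close> to \<open>q - i\<close> and periodicity give \<open>w (c - j) / j\<close>;
  oddness of \<open>w\<close> off the multiples of \<open>q\<close>, where coprimality enters,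
  identifies the case \<open>c = 0\<close> with \<open>- T\<close>.\<close>

lemma sum_saw_shift_le:
  fixes q :: nat and r c :: int
  assumes q: "q > 0" and co: "coprime r (int q)"
  defines "w \<equiv> \<lambda>m. saw (of_int (m * r) / real q)"
    and "T \<equiv> \<Sum>m=1..q-1. saw (real m * (of_int r / real q)) / real m"
  shows "\<bar>\<Sum>i=1..<q. w (c + int i) / real i\<bar> \<le> \<bar>T\<bar> + \<bar>of_int c\<bar>"
    and "\<bar>\<Sum>i=1..<q. w (c + int i) / (real q - real i)\<bar> \<le> \<bar>T\<bar> + \<bar>of_int c\<bar>"
proof -
  have w: "\<bar>w m\<bar> \<le> 1/2" for m unfolding w_def by (rule abs_saw_le)
  have per: "w (m + int q) = w m" for m
  proof -
    have "of_int ((m + int q) * r) / real q = of_int (m * r) / real q + of_int r"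
      using q by (simp add: field_simps)
    thus ?thesis unfolding w_def by (simp only: saw_add_of_int)
  qed
  have eq: "{1..<q} = {1..q-1}" using q by auto
  have T: "T = (\<Sum>i=1..<q. w (int i) / real i)" unfolding T_def eq w_def by simp
  have "\<bar>(\<Sum>i=1..<q. w (c + int i) / real i) - T\<bar> \<le> \<bar>of_int c\<bar>"
    unfolding T eq by (rule sum_over_index_shift) (rule w)
  thus "\<bar>\<Sum>i=1..<q. w (c + int i) / real i\<bar> \<le> \<bar>T\<bar> + \<bar>of_int c\<bar>" by linarith
  have odd: "w (- int i) = - w (int i)" if i: "i \<in> {1..<q}" for i
  proof -
    have "\<not> int q dvd int i"
      using i zdvd_imp_le[of "int q" "int i"] by auto
    hence "\<not> int q dvd int i * r" using co by (simp add: coprime_dvd_mult_left_iff coprime_commute)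
    hence "of_int (int i * r) / real q \<notin> \<int>"
      using of_int_divide_in_Ints_iff[of "int q" "int i * r"] q by simp
    thus ?thesis unfolding w_def using saw_minus by fastforce
  qed
  have "(\<Sum>i=1..<q. w (c + int i) / (real q - real i)) = (\<Sum>j=1..<q. w (- (- c + int j)) / real j)"
  proof (rule sum.reindex_bij_witness[of _ "\<lambda>i. q - i" "\<lambda>i. q - i"])
    fix i assume i: "i \<in> {1..<q}"
    have "w (- (- c + int (q - i))) = w (c + int i)"
      using per[of "- (- c + int (q - i))"] i by (simp add: of_nat_diff algebra_simps)
    thus "w (- (- c + int (q - i))) / real (q - i) = w (c + int i) / (real q - real i)"
      using i by (simp add: of_nat_diff)
  qed auto
  moreover have "\<bar>(\<Sum>j=1..<q. w (- (- c + int j)) / real j) - (\<Sum>j=1..<q. w (- int j) / real j)\<bar> \<le> \<bar>of_int (- c)\<bar>"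
    unfolding eq using sum_over_index_shift[of "\<lambda>m. w (- m)" "- c" "q - 1"] w by simp
  moreover have "(\<Sum>j=1..<q. w (- int j) / real j) = - T"
    unfolding T sum_negf[symmetric] by (intro sum.cong) (simp_all add: odd)
  ultimately show "\<bar>\<Sum>i=1..<q. w (c + int i) / (real q - real i)\<bar> \<le> \<bar>T\<bar> + \<bar>of_int c\<bar>"
    by simp
qed

text \<open>Subtracting the remainder from \<open>q\<close> sends residue 0 to \<open>q\<close>, in
  line with the index range of \<open>sine_prod\<close>. Coprimality gives injectivity, and counting
  does the rest.\<close>

lemma bij_betw_residues:
  fixes q :: nat and r c :: int
  assumes q: "q > 0" and co: "coprime r (int q)"
  shows "bij_betw (\<lambda>i. nat (int q - (c + int i) * r mod int q)) {..<q} {1..q}"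
proof -
  define f where "f i = nat (int q - (c + int i) * r mod int q)" for i :: nat
  have m: "0 \<le> x mod int q" "x mod int q < int q" for x using q by auto
  have sub: "f ` {..<q} \<subseteq> {1..q}"
  proof
    fix n assume "n \<in> f ` {..<q}"
    then obtain i where "n = f i" by auto
    thus "n \<in> {1..q}" unfolding f_def using m[of "(c + int i) * r"] by auto
  qed
  have inj: "inj_on f {..<q}"
  proof (rule inj_onI)
    fix i j assume ij: "i \<in> {..<q}" "j \<in> {..<q}" "f i = f j"
    have "(c + int i) * r mod int q = (c + int j) * r mod int q"
      using ij(3) m[of "(c + int i) * r"] m[of "(c + int j) * r"] unfolding f_def by (auto simp: nat_eq_iff split: if_splits)
    hence "int q dvd (c + int i) * r - (c + int j) * r" by (rule mod_eq_dvd_iff[THEN iffD1])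
    hence "int q dvd (int i - int j) * r" by (simp add: algebra_simps)
    hence d: "int q dvd int i - int j" using co by (simp add: coprime_dvd_mult_left_iff coprime_commute)
    have "\<bar>int i - int j\<bar> < int q" using ij by auto
    thus "i = j" using d dvd_imp_le_int[of "int i - int j" "int q"] by fastforce
  qed
  have "f ` {..<q} = {1..q}" using sub inj by (intro card_subset_eq) (auto simp: card_image)
  hence "bij_betw f {..<q} {1..q}" using inj by (simp add: bij_betw_def)
  thus ?thesis unfolding f_def[abs_def] .
qed

lemma abs_sin_pi_add_int: "\<bar>sin (pi * (of_int n + x))\<bar> = \<bar>sin (pi * x)\<bar>"
proof -
  have "sin (pi * of_int n + pi * x) = sin (pi * x) * cos (pi * of_int n)"
    by (simp add: sin_add sin_npi_int)
  moreover have "\<bar>cos (pi * of_int n)\<bar> = 1"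
    using sin_zero_abs_cos_one[of "pi * of_int n"] by (simp add: mult.commute)
  ultimately show ?thesis by (simp add: abs_mult distrib_left)
qed

text \<open>The factors are reindexed by the residues \<open>m = c + i\<close> of \<open>(-1) ^ k * n * p\<close> modulo \<open>q\<close>.\<close>

lemma sine_prod_reindex:
  fixes q :: nat and r p p' c :: int
  assumes q: "q > 0" and det: "p * r - p' * int q = (-1) ^ Suc k"
    and \<alpha>: "real q * \<alpha> - of_int p = (-1) ^ k * \<delta>"
  shows "sine_prod q \<alpha> ((-1) ^ k * x / real q)
       = (\<Prod>i<q. \<bar>2 * sin (pi * (real i + (of_int c + x + real q * \<delta> / 2)
            + real q * \<delta> * saw (of_int ((c + int i) * r) / real q)) / real q)\<bar>)"
proof -
  have co: "coprime r (int q)"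
  proof (rule coprimeI)
    fix d assume d: "d dvd r" "d dvd int q"
    hence "d dvd p * r - p' * int q" by (intro dvd_diff dvd_mult)
    thus "is_unit d" unfolding det using dvd_trans[of d "(-1) ^ Suc k" 1] by (simp add: is_unit_power_iff)
  qed
  have sgn: "\<bar>sin (pi * ((-1) ^ k * t))\<bar> = \<bar>sin (pi * t)\<bar>" for t
    by (cases "even k") auto
  have "sine_prod q \<alpha> ((-1) ^ k * x / real q)
      = (\<Prod>i<q. \<bar>2 * sin (pi * (real (nat (int q - (c + int i) * r mod int q)) * \<alpha> + (-1) ^ k * x / real q))\<bar>)"
    unfolding sine_prod_def by (rule prod.reindex_bij_betw[OF bij_betw_residues[OF q co], symmetric])
  also have "\<dots> = (\<Prod>i<q. \<bar>2 * sin (pi * (real i + (of_int c + x + real q * \<delta> / 2)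
            + real q * \<delta> * saw (of_int ((c + int i) * r) / real q)) / real q)\<bar>)"
  proof (rule prod.cong[OF refl])
    fix i
    define m where "m = c + int i"
    define N where "N = int q - m * r mod int q"
    define K where "K = p * (1 + m * r div int q) - m * p'"
    have "0 \<le> N" using q by (simp add: N_def less_imp_le)
    hence rN: "real (nat N) = of_int N" by simp
    have N2: "N = int q * (1 + m * r div int q) - m * r"
      using mult_div_mod_eq[of "int q" "m * r"] by (simp add: N_def algebra_simps)
    have pr: "p * r = p' * int q - (-1) ^ k" using det by simp
    \<comment> \<open>Modulo \<open>q\<close>, \<open>r\<close> inverts \<open>p\<close> up to sign
      and \<open>N\<close> is \<open>- m * r\<close>, so \<open>N * p\<close> is
      \<open>(-1) ^ k * m\<close>. The quotient \<open>K\<close> disappears by periodicity of the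
      absolute sine.\<close>
    have "N * p = int q * (p * (1 + m * r div int q)) - m * (p * r)" by (simp add: N2 algebra_simps)
    also have "\<dots> = int q * K + (-1) ^ k * m" unfolding pr K_def by (simp add: algebra_simps)
    finally have "N * p = int q * K + (-1) ^ k * m" .
    hence "real_of_int (N * p) = of_int (int q * K + (-1) ^ k * m)" by (rule arg_cong)
    hence Np: "of_int N * of_int p = real q * of_int K + (-1) ^ k * of_int m" by simp
    \<comment> \<open>This splits the displacement \<open>N * \<delta>\<close> into its mean
      \<open>q * \<delta> / 2\<close>, which joins the shift, and the oscillating sawtooth
      term.\<close>
    have sw: "of_int N = real q * (1/2 + saw (of_int (m * r) / real q))"
    proof -
      have "\<lfloor>of_int (m * r) / real q\<rfloor> = m * r div int q"
        using floor_divide_of_int_eq[of "m * r" "int q", where 'a = real] by simp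
      hence "frac (of_int (m * r) / real q) = of_int (m * r) / real q - of_int (m * r div int q)"
        by (simp add: frac_def)
      thus ?thesis using q unfolding saw_def N2 by (simp add: field_simps)
    qed
    have "\<alpha> = of_int p / real q + (-1) ^ k * \<delta> / real q" using \<alpha> q by (simp add: field_simps)
    hence "of_int N * \<alpha> + (-1) ^ k * x / real q = of_int N * of_int p / real q + (-1) ^ k * (of_int N * \<delta> + x) / real q"
      by (simp add: algebra_simps add_divide_distrib)
    also have "\<dots> = of_int K + (-1) ^ k * ((of_int m + x + of_int N * \<delta>) / real q)"
      unfolding Np using q by (simp add: field_simps)
    finally have arg: "of_int N * \<alpha> + (-1) ^ k * x / real q = \<dots>" .
    have "\<bar>sin (pi * (of_int N * \<alpha> + (-1) ^ k * x / real q))\<bar> = \<bar>sin (pi * ((-1) ^ k * ((of_int m + x + of_int N * \<delta>) / real q)))\<bar>"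
      unfolding arg by (rule abs_sin_pi_add_int)
    also have "\<dots> = \<bar>sin (pi * ((of_int m + x + of_int N * \<delta>) / real q))\<bar>"
      by (rule sgn)
    also have "of_int m + x + of_int N * \<delta> = real i + (of_int c + x + real q * \<delta> / 2)
            + real q * \<delta> * saw (of_int (m * r) / real q)"
      unfolding sw by (simp add: m_def algebra_simps)
    finally show "\<bar>2 * sin (pi * (real (nat (int q - (c + int i) * r mod int q)) * \<alpha> + (-1) ^ k * x / real q))\<bar>
      = \<bar>2 * sin (pi * (real i + (of_int c + x + real q * \<delta> / 2)
            + real q * \<delta> * saw (of_int ((c + int i) * r) / real q)) / real q)\<bar>"
      unfolding m_def[symmetric] N_def[symmetric] rN by (simp add: abs_mult)
  qed
  finally show ?thesis .
qed

text \<open>The constant \<open>111 + 2 * X\<close> is 109 plus \<open>X + 1\<close> for the shift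
  \<open>c\<close> in each of the two sums, 66 is twice the 33 of
  \<open>saw_sum_le_cf_log_sum\<close>, and 68 is 64 plus 4 for replacing \<open>y\<close> by
  \<open>x\<close>.\<close>

lemma sine_prod_cf_q_approx:
  fixes \<alpha> x X :: real
  assumes irr: "\<alpha> \<notin> \<rat>" and x: "\<bar>x\<bar> \<le> X"
    and E: "E = (111 + 2 * X + 66 * cf_log_sum \<alpha> k) / of_int (cf_a \<alpha> (k + 1))" "E \<le> 1"
    and a2: "cf_a \<alpha> (k + 1) \<ge> 2"
  shows "\<bar>sine_prod (nat (cf_q \<alpha> k)) \<alpha> ((-1) ^ k * x / of_int (cf_q \<alpha> k)) - \<bar>2 * sin (pi * x)\<bar>\<bar> \<le> 68 * E"
proof -
  define q where "q = nat (cf_q \<alpha> k)"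
  define r where "r = cf_q_pred \<alpha> k"
  define a where "a = cf_a \<alpha> (k + 1)"
  define \<rho> where "\<rho> = cf_rest \<alpha> (Suc k)"
  have iq: "int q = cf_q \<alpha> k" using cf_q_pos[OF irr, of k] by (simp add: q_def)
  hence rq: "real_of_int (cf_q \<alpha> k) = real q" by (metis of_int_of_nat_eq)
  have q: "q > 0" using cf_q_pos[OF irr, of k] by (simp add: q_def)
  have r: "r \<ge> 0" unfolding r_def by (rule cf_q_pred_nonneg[OF irr])
  have co: "coprime r (int q)" unfolding iq r_def by (rule coprime_cf_q_pred[OF irr])
  obtain p p' where p: "p * r - p' * int q = (-1) ^ Suc k"
      "\<alpha> * (real q * \<rho> + of_int r) = of_int p * \<rho> + of_int p'"
    using cf_numerators[OF irr, of k] unfolding iq r_def \<rho>_def rq by blast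
  have \<rho>: "1 < \<rho>" "of_int a \<le> \<rho>"
    unfolding \<rho>_def a_def cf_a_def using cf_rest_Suc_gt_1[OF irr, of k] by (simp_all del: cf_rest.simps)
  define D where "D = real q * \<rho> + of_int r"
  have D: "D > 0" unfolding D_def using q \<rho> r by (simp add: add_pos_nonneg)
  define \<delta> where "\<delta> = 1 / D"
  define \<eta> where "\<eta> = real q * \<delta>"
  have \<alpha>: "real q * \<alpha> - of_int p = (-1) ^ k * \<delta>"
  proof -
    have "(real q * \<alpha> - of_int p) * D = real q * (\<alpha> * D) - of_int p * D" by (simp add: algebra_simps)
    also have "\<dots> = real q * (of_int p * \<rho> + of_int p') - of_int p * D" unfolding D_def p(2) ..
    also have "\<dots> = - of_int (p * r - p' * int q)" by (simp add: D_def algebra_simps)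
    also have "\<dots> = (-1) ^ k" unfolding p(1) by simp
    finally show ?thesis using D by (simp add: \<delta>_def field_simps)
  qed
  have a: "a \<ge> 2" using a2 by (simp add: a_def)
  have \<eta>: "0 \<le> \<eta>" "\<eta> \<le> 1 / of_int a"
  proof -
    show "0 \<le> \<eta>" using D by (simp add: \<eta>_def \<delta>_def)
    have "real q * of_int a \<le> real q * \<rho>" using \<rho> by (intro mult_left_mono) auto
    hence "real q * of_int a \<le> D" using r by (simp add: D_def)
    thus "\<eta> \<le> 1 / of_int a" using D a by (simp add: \<eta>_def \<delta>_def field_simps)
  qed
  have "1 / real_of_int a \<le> 1 / 2" using a by (intro divide_left_mono) auto
  hence \<eta>2: "\<eta> \<le> 1/2" using \<eta> by linarith
  define y where "y = x + \<eta> / 2"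
  \<comment> \<open>Recentring at the nearest integer puts the factor closest to a zero of the sine
    at \<open>i = 0\<close> and ensures \<open>\<bar>s\<bar> \<le> 1/2\<close>.\<close>
  define c where "c = - round y"
  define s where "s = of_int c + y"
  have s: "\<bar>s\<bar> \<le> 1/2" using of_int_round_abs_le[of y] by (simp add: s_def c_def abs_minus_commute)
  have cX: "\<bar>of_int c\<bar> \<le> X + 1" using s x \<eta> \<eta>2 unfolding s_def y_def by linarith
  define T where "T = (\<Sum>m=1..q-1. saw (real m * (of_int r / real q)) / real m)"
  have T: "\<bar>T\<bar> \<le> 33 * cf_log_sum \<alpha> k"
    using saw_sum_le_cf_log_sum[OF irr, of "q - 1" k] q
    unfolding T_def r_def rq iq[symmetric] by (simp add: of_nat_diff)
  define w where "w i = saw (of_int ((c + int i) * r) / real q)" for i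
  have AB: "\<bar>\<Sum>i=1..<q. w i / real i\<bar> \<le> \<bar>T\<bar> + \<bar>of_int c\<bar>"
    "\<bar>\<Sum>i=1..<q. w i / (real q - real i)\<bar> \<le> \<bar>T\<bar> + \<bar>of_int c\<bar>"
    unfolding w_def T_def by (rule sum_saw_shift_le[OF q co])+
  have E1: "\<eta> * (109 + \<bar>\<Sum>i=1..<q. w i / real i\<bar> + \<bar>\<Sum>i=1..<q. w i / (real q - real i)\<bar>) \<le> E"
  proof -
    have "109 + \<bar>\<Sum>i=1..<q. w i / real i\<bar> + \<bar>\<Sum>i=1..<q. w i / (real q - real i)\<bar>
        \<le> 111 + 2 * X + 66 * cf_log_sum \<alpha> k" using AB cX T by linarith
    hence "\<eta> * (109 + \<bar>\<Sum>i=1..<q. w i / real i\<bar> + \<bar>\<Sum>i=1..<q. w i / (real q - real i)\<bar>)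
        \<le> 1 / of_int a * (111 + 2 * X + 66 * cf_log_sum \<alpha> k)"
      using \<eta> a by (intro mult_mono) auto
    thus ?thesis by (simp add: E(1) a_def)
  qed
  have "\<bar>(\<Prod>i<q. \<bar>2 * sin (pi * (real i + s + \<eta> * w i) / real q)\<bar>) - \<bar>2 * sin (pi * s)\<bar>\<bar> \<le> 64 * E"
    by (rule prod_sin_perturb[OF q _ s \<eta>(1) \<eta>2 E1 E(2)]) (unfold w_def, rule abs_saw_le)
  moreover have "sine_prod q \<alpha> ((-1) ^ k * x / real q) = (\<Prod>i<q. \<bar>2 * sin (pi * (real i + s + \<eta> * w i) / real q)\<bar>)"
    unfolding sine_prod_reindex[OF q p(1) \<alpha>, where c = c] w_def s_def y_def \<eta>_def by (simp add: add_ac)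
  moreover have "\<bar>2 * sin (pi * s)\<bar> = \<bar>2 * sin (pi * y)\<bar>"
    unfolding s_def abs_mult abs_sin_pi_add_int ..
  moreover have "\<bar>\<bar>2 * sin (pi * y)\<bar> - \<bar>2 * sin (pi * x)\<bar>\<bar> \<le> 4 * \<eta>"
  proof -
    have "\<bar>\<bar>2 * sin (pi * y)\<bar> - \<bar>2 * sin (pi * x)\<bar>\<bar> \<le> 2 * \<bar>pi * y - pi * x\<bar>"
      by (rule abs_two_sin_lipschitz)
    also have "\<dots> = pi * \<eta>" using \<eta> by (simp add: y_def distrib_left)
    also have "\<dots> \<le> 4 * \<eta>" using \<eta> pi_less_4 by (intro mult_right_mono) auto
    finally show ?thesis .
  qed
  moreover have "\<eta> \<le> E"
  proof -
    have "\<eta> * 1 \<le> \<eta> * (109 + \<bar>\<Sum>i=1..<q. w i / real i\<bar> + \<bar>\<Sum>i=1..<q. w i / (real q - real i)\<bar>)"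
      using \<eta> by (intro mult_left_mono) auto
    thus ?thesis using E1 by linarith
  qed
  ultimately show ?thesis unfolding q_def[symmetric] rq by linarith
qed

section \<open>Passage to the limit\<close>

text \<open>Compactness enters through the bound \<open>X\<close>, which makes the error
  \<open>68 * E m\<close> uniform on \<open>K\<close>. Both claims of the theorem are
  instances.\<close>

lemma uniform_limit_sine_prod:
  fixes km :: "nat \<Rightarrow> nat"
  assumes irr: "\<alpha> \<notin> \<rat>" and K: "compact K"
    and a: "filterlim (\<lambda>m. real_of_int (cf_a \<alpha> (km m + 1))) at_top sequentially"
    and lim: "(\<lambda>m. cf_log_sum \<alpha> (km m) / of_int (cf_a \<alpha> (km m + 1))) \<longlonglongrightarrow> 0"
  shows "uniform_limit K (\<lambda>m x. sine_prod (nat (cf_q \<alpha> (km m))) \<alpha>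
           ((-1) ^ km m * x / real_of_int (cf_q \<alpha> (km m)))) (\<lambda>x. \<bar>2 * sin (pi * x)\<bar>) sequentially"
proof -
  obtain X where X: "\<And>x. x \<in> K \<Longrightarrow> \<bar>x\<bar> \<le> X"
    using compact_imp_bounded[OF K] by (auto simp: bounded_iff)
  define E where "E m = (111 + 2 * X + 66 * cf_log_sum \<alpha> (km m)) / of_int (cf_a \<alpha> (km m + 1))" for m
  have "(\<lambda>m. (111 + 2 * X) / real_of_int (cf_a \<alpha> (km m + 1))) \<longlonglongrightarrow> 0"
    by (intro tendsto_divide_0[OF tendsto_const] filterlim_at_top_imp_at_infinity a)
  from tendsto_add[OF this tendsto_mult_left[OF lim, of 66]]
  have E0: "E \<longlonglongrightarrow> 0" by (simp add: E_def[abs_def] add_divide_distrib)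
  have a2: "eventually (\<lambda>m. 2 \<le> real_of_int (cf_a \<alpha> (km m + 1))) sequentially"
    using a[unfolded filterlim_at_top, rule_format, of 2] .
  show ?thesis
  proof (rule uniform_limitI)
    fix e :: real assume e: "e > 0"
    have "eventually (\<lambda>m. E m < min 1 (e / 68)) sequentially"
      using e by (intro order_tendstoD(2)[OF E0]) auto
    with a2 show "\<forall>\<^sub>F m in sequentially. \<forall>x\<in>K. dist (sine_prod (nat (cf_q \<alpha> (km m))) \<alpha>
           ((-1) ^ km m * x / real_of_int (cf_q \<alpha> (km m)))) \<bar>2 * sin (pi * x)\<bar> < e"
    proof eventually_elim
      case (elim m)
      show ?case
      proof
        fix x assume "x \<in> K"
        hence "\<bar>sine_prod (nat (cf_q \<alpha> (km m))) \<alpha> ((-1) ^ km m * x / of_int (cf_q \<alpha> (km m))) - \<bar>2 * sin (pi * x)\<bar>\<bar> \<le> 68 * E m"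
          using elim by (intro sine_prod_cf_q_approx[OF irr X]) (auto simp: E_def)
        also have "\<dots> < e" using elim by simp
        finally show "dist (sine_prod (nat (cf_q \<alpha> (km m))) \<alpha>
           ((-1) ^ km m * x / real_of_int (cf_q \<alpha> (km m)))) \<bar>2 * sin (pi * x)\<bar> < e"
          by (simp add: dist_real_def)
      qed
    qed
  qed
qed

text \<open>Extracts the divergence of \<open>a_(k+1)\<close> from the limit hypotheses of the
  theorem, whose numerators are at least 1 thanks to the summand 1.\<close>

lemma filterlim_at_top_of_ratio:
  fixes f g :: "nat \<Rightarrow> real"
  assumes "(\<lambda>m. f m / g m) \<longlonglongrightarrow> 0" "eventually (\<lambda>m. 1 \<le> f m) sequentially"
    "eventually (\<lambda>m. 0 < g m) sequentially"
  shows "filterlim g at_top sequentially"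
proof -
  have "eventually (\<lambda>m. 0 < f m / g m) sequentially"
    using assms(2,3) by eventually_elim simp
  hence "filterlim (\<lambda>m. inverse (f m / g m)) at_top sequentially"
    by (intro filterlim_inverse_at_top assms(1))
  thus ?thesis
    by (rule filterlim_at_top_mono) (use assms(2,3) in eventually_elim, auto simp: field_simps)
qed

theorem theorem5:
  fixes \<alpha> :: real
  assumes irr: "\<alpha> \<notin> \<rat>"
    and unbdd: "\<forall>B::real. \<exists>k\<ge>1. real_of_int (cf_a \<alpha> k) > B"
  shows "(\<forall>km :: nat \<Rightarrow> nat.
            strict_mono km \<and> (\<forall>m. km m \<ge> 1) \<and>
            ((\<lambda>m. (1 + ln (real_of_int (Max (cf_a \<alpha> ` {1..km m}))))
                   / real_of_int (cf_a \<alpha> (km m + 1))) \<longlonglongrightarrow> 0)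
          \<longrightarrow> (\<forall>K. compact K \<longrightarrow>
                uniform_limit K
                  (\<lambda>m x. sine_prod (nat (cf_q \<alpha> (km m))) \<alpha>
                           ((-1) ^ km m * x / real_of_int (cf_q \<alpha> (km m))))
                  (\<lambda>x. \<bar>2 * sin (pi * x)\<bar>) sequentially))
       \<and> (((\<lambda>k. (1 + ln (real_of_int (cf_a \<alpha> k))) / real_of_int (cf_a \<alpha> (k + 1))) \<longlonglongrightarrow> 0)
          \<longrightarrow> (\<forall>K. compact K \<longrightarrow>
                uniform_limit K
                  (\<lambda>m x. sine_prod (nat (cf_q \<alpha> m)) \<alpha>
                           ((-1) ^ m * x / real_of_int (cf_q \<alpha> m)))
                  (\<lambda>x. \<bar>2 * sin (pi * x)\<bar>) sequentially))"
proof (intro conjI allI impI, elim conjE)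
  fix km :: "nat \<Rightarrow> nat" and K :: "real set"
  assume K: "compact K" and km: "\<forall>m. km m \<ge> 1"
    and lim: "(\<lambda>m. (1 + ln (real_of_int (Max (cf_a \<alpha> ` {1..km m})))) / real_of_int (cf_a \<alpha> (km m + 1))) \<longlonglongrightarrow> 0"
  have apos: "0 < cf_a \<alpha> (km m + 1)" for m using cf_a_Suc_ge_1[OF irr, of "km m"] by simp
  have max: "1 \<le> Max (cf_a \<alpha> ` {1..km m})" for m
  proof -
    have "cf_a \<alpha> 1 \<le> Max (cf_a \<alpha> ` {1..km m})" using km by (intro Max_ge) auto
    thus ?thesis using cf_a_ge_1[OF irr, of 1] by simp
  qed
  show "uniform_limit K (\<lambda>m x. sine_prod (nat (cf_q \<alpha> (km m))) \<alpha> ((-1) ^ km m * x / real_of_int (cf_q \<alpha> (km m))))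
          (\<lambda>x. \<bar>2 * sin (pi * x)\<bar>) sequentially"
  proof (rule uniform_limit_sine_prod[OF irr K])
    show "filterlim (\<lambda>m. real_of_int (cf_a \<alpha> (km m + 1))) at_top sequentially"
      by (rule filterlim_at_top_of_ratio[OF lim]) (use max apos in auto)
    show "(\<lambda>m. cf_log_sum \<alpha> (km m) / of_int (cf_a \<alpha> (km m + 1))) \<longlonglongrightarrow> 0"
    proof (rule tendsto_sandwich[OF _ _ tendsto_const])
      show "(\<lambda>m. 3 * ((1 + ln (real_of_int (Max (cf_a \<alpha> ` {1..km m})))) / real_of_int (cf_a \<alpha> (km m + 1)))) \<longlonglongrightarrow> 0"
        using tendsto_mult_left[OF lim, of 3] by simp
      show "\<forall>\<^sub>F m in sequentially. 0 \<le> cf_log_sum \<alpha> (km m) / of_int (cf_a \<alpha> (km m + 1))"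
        using apos by (intro always_eventually allI divide_nonneg_pos cf_log_sum_nonneg[OF irr]) auto
      show "\<forall>\<^sub>F m in sequentially. cf_log_sum \<alpha> (km m) / of_int (cf_a \<alpha> (km m + 1))
          \<le> 3 * ((1 + ln (real_of_int (Max (cf_a \<alpha> ` {1..km m})))) / real_of_int (cf_a \<alpha> (km m + 1)))"
      proof (intro always_eventually allI)
        fix m
        have "cf_log_sum \<alpha> (km m) \<le> 3 * (1 + ln (of_int (Max (cf_a \<alpha> ` {1..km m}))))"
          using km by (intro cf_log_sum_le_Max[OF irr]) auto
        from divide_right_mono[OF this, of "of_int (cf_a \<alpha> (km m + 1))"] apos[of m]
        show "cf_log_sum \<alpha> (km m) / of_int (cf_a \<alpha> (km m + 1))
          \<le> 3 * ((1 + ln (real_of_int (Max (cf_a \<alpha> ` {1..km m})))) / real_of_int (cf_a \<alpha> (km m + 1)))"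
          by simp
      qed
    qed
  qed
next
  fix K :: "real set"
  assume K: "compact K"
    and lim: "(\<lambda>k. (1 + ln (real_of_int (cf_a \<alpha> k))) / real_of_int (cf_a \<alpha> (k + 1))) \<longlonglongrightarrow> 0"
  have apos: "0 < cf_a \<alpha> (k + 1)" for k using cf_a_Suc_ge_1[OF irr, of k] by simp
  have a: "filterlim (\<lambda>k. real_of_int (cf_a \<alpha> (k + 1))) at_top sequentially"
  proof (rule filterlim_at_top_of_ratio[OF lim])
    \<comment> \<open>Only indices from 1 on are covered: \<open>cf_a \<alpha> 0\<close> is the
      floor of \<open>\<alpha>\<close> and may be nonpositive.\<close>
    show "\<forall>\<^sub>F k in sequentially. 1 \<le> 1 + ln (real_of_int (cf_a \<alpha> k))"
      using eventually_ge_at_top[of 1] by eventually_elim (use cf_a_ge_1[OF irr] in force)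
  qed (use apos in auto)
  \<comment> \<open>A convergent sequence is bounded; its bound is the constant required by
    \<open>cf_log_sum_le_last\<close>.\<close>
  obtain B where "\<forall>k. norm ((1 + ln (real_of_int (cf_a \<alpha> k))) / real_of_int (cf_a \<alpha> (k + 1))) \<le> B"
    using convergent_imp_Bseq[OF convergentI[OF lim]] unfolding Bseq_def by blast
  hence B: "(1 + ln (real_of_int (cf_a \<alpha> k))) / real_of_int (cf_a \<alpha> (k + 1)) \<le> B" for k
    unfolding real_norm_def using abs_le_D1 by blast
  have Ba: "1 + ln (of_int (cf_a \<alpha> l)) \<le> B * of_int (cf_a \<alpha> (Suc l))" for l
    using B[of l] apos[of l] by (simp add: field_simps)
  show "uniform_limit K (\<lambda>m x. sine_prod (nat (cf_q \<alpha> m)) \<alpha> ((-1) ^ m * x / real_of_int (cf_q \<alpha> m)))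
          (\<lambda>x. \<bar>2 * sin (pi * x)\<bar>) sequentially"
  proof (rule uniform_limit_sine_prod[OF irr K a])
    show "(\<lambda>m. cf_log_sum \<alpha> m / of_int (cf_a \<alpha> (m + 1))) \<longlonglongrightarrow> 0"
    proof (rule tendsto_sandwich[OF _ _ tendsto_const])
      have "(\<lambda>m. 3 * B / real_of_int (cf_a \<alpha> (m + 1))) \<longlonglongrightarrow> 0"
        by (intro tendsto_divide_0[OF tendsto_const] filterlim_at_top_imp_at_infinity a)
      from tendsto_add[OF lim this]
      show "(\<lambda>m. (1 + ln (real_of_int (cf_a \<alpha> m))) / real_of_int (cf_a \<alpha> (m + 1)) + 3 * B / real_of_int (cf_a \<alpha> (m + 1))) \<longlonglongrightarrow> 0"
        by simp
      show "\<forall>\<^sub>F m in sequentially. 0 \<le> cf_log_sum \<alpha> m / of_int (cf_a \<alpha> (m + 1))"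
        using apos by (intro always_eventually allI divide_nonneg_pos cf_log_sum_nonneg[OF irr]) auto
      show "\<forall>\<^sub>F m in sequentially. cf_log_sum \<alpha> m / of_int (cf_a \<alpha> (m + 1))
          \<le> (1 + ln (real_of_int (cf_a \<alpha> m))) / real_of_int (cf_a \<alpha> (m + 1)) + 3 * B / real_of_int (cf_a \<alpha> (m + 1))"
        using eventually_ge_at_top[of 1]
      proof eventually_elim
        case (elim m)
        from divide_right_mono[OF cf_log_sum_le_last[OF irr elim Ba], of "of_int (cf_a \<alpha> (m + 1))"] apos[of m]
        show ?case by (simp add: add_divide_distrib)
      qed
    qed
  qed
qed

end
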